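(* Fix $r,q\in\mathbb N$. Consider the Cauchy problems $$\dot a_i=a_i\Big(\prod_{j=1}^{r}a_{i+j}-\prod_{j=1}^{r}a_{i-j}\Big),\qquad \dot b_i=b_i\Big(\sum_{j=1}^{q}b_{i+j}-\sum_{j=1}^{q}b_{i-j}\Big),\qquad i\in\mathbb Z_+,$$ with $a_l=b_l=0$ for $l<0$, in the class of solutions with $a_i(t),b_i(t)\in\mathbb C\setminus\{0\}$ and $(a_i(t))_{i\ge0},(b_i(t))_{i\ge0}\in l_\infty$ for each $t$. For any initial data $(a_i(0))_{i\ge0},(b_i(0))_{i\ge0}\in l_\infty$ with all $a_i(0),b_i(0)\neq0$, there exists $\delta>0$ such that both Cauchy problems have unique solutions on $t\in[0,\delta)$, and these solutions are obtained as follows. Let $L1(0)$ and $L2(0)$ be the matrices built from the initial data (see context) and compute the initial moments $S^{m,1}_k(0)=(L1(0)^k)_{m-1,0}$ ($m=1,\dots,r$) and $S^{1,n}_k(0)=(L2(0)^k)_{0,n-1}$ ($n=1,\dots,q$). For $t\in[0,\delta)$ and $k\ge 0$ set $$S^{m,1}_k(t)=\frac{\sum_{l=0}^\infty S^{m,1}_{k+(r+1)l}(0)\,t^l/l!}{\sum_{l=0}^\infty S^{1,1}_{(r+1)l}(0)\,t^l/l!},\qquad S^{1,n}_k(t)=\frac{\sum_{l=0}^\infty S^{1,n}_{k+(q+1)l}(0)\,t^l/l!}{\sum_{l=0}^\infty S^{1,n}_{n-1+(q+1)l}(0)\,t^l/l!}.$$ Form $\Delta^{(1)}_k(t)=\det(\alpha_{i,j}(t))_{i,j=0}^k$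 with $\alpha_{i,j}(t)=S^{\operatorname{rem}(i,r)+1,\,1}_{\lfloor i/r\rfloor+j}(t)$, and $\Delta^{(2)}_k(t)=\det(\beta_{i,j}(t))_{i,j=0}^k$ with $\beta_{i,j}(t)=S^{1,\,\operatorname{rem}(j,q)+1}_{i+\lfloor j/q\rfloor}(t)$, with $\Delta^{(1)}_{-1}=\Delta^{(2)}_{-1}=1$. Then for all $i\ge 0$ and $t\in[0,\delta)$, $$a_i(t)=\frac{\Delta^{(1)}_{i+1}(t)\Delta^{(1)}_{i-1}(t)}{\Delta^{(1)}_i(t)^2},\qquad b_i(t)=\frac{\Delta^{(2)}_{i+q}(t)\Delta^{(2)}_{i-1}(t)}{\Delta^{(2)}_{i+q-1}(t)\Delta^{(2)}_i(t)}.$$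
   Context: For a sequence $(a_i)$, $L1$ is the infinite matrix (indices $\ge 0$) with $(L1)_{i,i+r}=1$, $(L1)_{i+1,i}=a_i$ for $i\ge 0$ and all other entries zero; for $(b_i)$, $L2$ is the infinite matrix with $(L2)_{i,i+1}=1$, $(L2)_{i+q,i}=b_i$ for $i\ge0$ and all other entries zero. $\operatorname{rem}(a,b)$ is the remainder of $a$ modulo $b$; matrix powers are ordinary products of banded matrices. *)

theory Defs
  imports Complex_Main "Jordan_Normal_Form.Determinant"
begin

text \<open>Infinite matrices indexed by nat x nat, as functions.  Powers of a
matrix whose nonzero entries in row i lie in columns \<le> i + w (upper bandwidth w);
the sum over columns is then exactly the ordinary (finite) matrix product.\<close>

fun bpow :: "nat \<Rightarrow> (nat \<Rightarrow> nat \<Rightarrow> complex) \<Rightarrow> nat \<Rightarrow> nat \<Rightarrow> nat \<Rightarrow> complex" where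
  "bpow w M 0 i j = (if i = j then 1 else 0)"
| "bpow w M (Suc k) i j = (\<Sum>l\<le>i + w. M i l * bpow w M k l j)"

definition L1 :: "nat \<Rightarrow> (nat \<Rightarrow> complex) \<Rightarrow> nat \<Rightarrow> nat \<Rightarrow> complex" where
  "L1 r a i j = (if j = i + r then 1 else 0) + (if i = j + 1 then a j else 0)"

definition L2 :: "nat \<Rightarrow> (nat \<Rightarrow> complex) \<Rightarrow> nat \<Rightarrow> nat \<Rightarrow> complex" where
  "L2 q b i j = (if j = i + 1 then 1 else 0) + (if i = j + q then b j else 0)"

definition S1_0 :: "nat \<Rightarrow> (nat \<Rightarrow> complex) \<Rightarrow> nat \<Rightarrow> nat \<Rightarrow> complex" where
  "S1_0 r a m k = bpow (max r 1) (L1 r a) k (m - 1) 0"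

definition S2_0 :: "nat \<Rightarrow> (nat \<Rightarrow> complex) \<Rightarrow> nat \<Rightarrow> nat \<Rightarrow> complex" where
  "S2_0 q b n k = bpow 1 (L2 q b) k 0 (n - 1)"

definition S1_num :: "nat \<Rightarrow> (nat \<Rightarrow> complex) \<Rightarrow> nat \<Rightarrow> nat \<Rightarrow> real \<Rightarrow> nat \<Rightarrow> complex" where
  "S1_num r a m k t l = S1_0 r a m (k + (r + 1) * l) * of_real (t ^ l / fact l)"

definition S1_den :: "nat \<Rightarrow> (nat \<Rightarrow> complex) \<Rightarrow> real \<Rightarrow> nat \<Rightarrow> complex" where
  "S1_den r a t l = S1_0 r a 1 ((r + 1) * l) * of_real (t ^ l / fact l)"

definition S2_num :: "nat \<Rightarrow> (nat \<Rightarrow> complex) \<Rightarrow> nat \<Rightarrow> nat \<Rightarrow> real \<Rightarrow> nat \<Rightarrow> complex" where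
  "S2_num q b n k t l = S2_0 q b n (k + (q + 1) * l) * of_real (t ^ l / fact l)"

definition S2_den :: "nat \<Rightarrow> (nat \<Rightarrow> complex) \<Rightarrow> nat \<Rightarrow> real \<Rightarrow> nat \<Rightarrow> complex" where
  "S2_den q b n t l = S2_0 q b n (n - 1 + (q + 1) * l) * of_real (t ^ l / fact l)"

definition S1 :: "nat \<Rightarrow> (nat \<Rightarrow> complex) \<Rightarrow> nat \<Rightarrow> nat \<Rightarrow> real \<Rightarrow> complex" where
  "S1 r a m k t = suminf (S1_num r a m k t) / suminf (S1_den r a t)"

definition S2 :: "nat \<Rightarrow> (nat \<Rightarrow> complex) \<Rightarrow> nat \<Rightarrow> nat \<Rightarrow> real \<Rightarrow> complex" where
  "S2 q b n k t = suminf (S2_num q b n k t) / suminf (S2_den q b n t)"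

text \<open>Hankel-type determinants.  D1 r a t N is the determinant of the N x N matrix
(alpha_{i,j})_{i,j<N}, so Delta^{(1)}_k = D1 r a t (k+1) and Delta^{(1)}_{-1} = D1 r a t 0 = 1.\<close>
definition D1 :: "nat \<Rightarrow> (nat \<Rightarrow> complex) \<Rightarrow> real \<Rightarrow> nat \<Rightarrow> complex" where
  "D1 r a t N = det (mat N N (\<lambda>(i, j). S1 r a (i mod r + 1) (i div r + j) t))"

definition D2 :: "nat \<Rightarrow> (nat \<Rightarrow> complex) \<Rightarrow> real \<Rightarrow> nat \<Rightarrow> complex" where
  "D2 q b t N = det (mat N N (\<lambda>(i, j). S2 q b (j mod q + 1) (i + j div q) t))"

definition ext0 :: "(nat \<Rightarrow> complex) \<Rightarrow> int \<Rightarrow> complex" where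
  "ext0 a l = (if l < 0 then 0 else a (nat l))"

definition sol1 :: "nat \<Rightarrow> real \<Rightarrow> (nat \<Rightarrow> complex) \<Rightarrow> (real \<Rightarrow> nat \<Rightarrow> complex) \<Rightarrow> bool" where
  "sol1 r \<delta> a0 a \<longleftrightarrow>
     a 0 = a0 \<and>
     (\<forall>t\<in>{0..<\<delta>}. (\<forall>i. a t i \<noteq> 0) \<and> (\<exists>C. \<forall>i. norm (a t i) \<le> C)) \<and>
     (\<forall>t\<in>{0..<\<delta>}. \<forall>i. ((\<lambda>s. a s i) has_vector_derivative
        a t i * ((\<Prod>j=1..r. ext0 (a t) (int i + int j)) - (\<Prod>j=1..r. ext0 (a t) (int i - int j))))
        (at t within {0..<\<delta>}))"

definition sol2 :: "nat \<Rightarrow> real \<Rightarrow> (nat \<Rightarrow> complex) \<Rightarrow> (real \<Rightarrow> nat \<Rightarrow> complex) \<Rightarrow> bool" where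
  "sol2 q \<delta> b0 b \<longleftrightarrow>
     b 0 = b0 \<and>
     (\<forall>t\<in>{0..<\<delta>}. (\<forall>i. b t i \<noteq> 0) \<and> (\<exists>C. \<forall>i. norm (b t i) \<le> C)) \<and>
     (\<forall>t\<in>{0..<\<delta>}. \<forall>i. ((\<lambda>s. b s i) has_vector_derivative
        b t i * ((\<Sum>j=1..q. ext0 (b t) (int i + int j)) - (\<Sum>j=1..q. ext0 (b t) (int i - int j))))
        (at t within {0..<\<delta>}))"

end

theory Submission
  imports Defs "HOL-Analysis.Analysis"
begin

text \<open>
  Both systems are Lax equations \<open>L' = L A - A L\<close>. The moments then satisfy
  \<open>S_k' = S_(k + p + 1) - d S_k\<close> with a function \<open>d\<close> that does not depend on \<open>k\<close>, so after
  multiplication by \<open>exp (\<integral> d)\<close> differentiation is a mere shift of the index and the moments are given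
  by their Taylor series at \<open>0\<close>. As the solutions are only bounded for each fixed \<open>t\<close>, the
  convergence of these series to the moments needs a Baire category argument. The solution is read off
  from the moments at time \<open>t\<close> by factorising the moment matrix into triangular matrices. Existence
  for the second system is a power series computation; the first system reduces to the second one.
\<close>

hide_const (open) Determinants.det Finite_Cartesian_Product.mat Finite_Cartesian_Product.vec

subsection \<open>Taylor series of functions of pointwise exponential type\<close>

text \<open>Boundedness at each separate time gives no control that is uniform in time, so
  uniqueness does not follow directly from a Lipschitz estimate in the space of bounded sequences.
  At a fixed time it does bound the \<open>k\<close>-th moment geometrically in \<open>k\<close>;
  since higher derivatives are later moments, this is a pointwise bound on all derivatives.
  Uniqueness is then a by-product: the formulas hold for an arbitrary solution, and their right-hand
  sides contain only initial data. Each denominator in the moment quotients is the series of a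
  moment that is identically 1. Its sum is the exponential factor itself, hence nonzero, and the
  time interval is limited by existence alone.\<close>

lemma sums_Taylor_uniformly_bounded:
  fixes F :: "nat \<Rightarrow> real \<Rightarrow> real"
  assumes S: "convex S"
    and F: "\<And>k x. x \<in> S \<Longrightarrow> (F k has_real_derivative F (Suc k) x) (at x within S)"
    and B: "\<And>k x. x \<in> S \<Longrightarrow> \<bar>F k x\<bar> \<le> M ^ Suc k"
    and w: "w \<in> S" and z: "z \<in> S"
  shows "(\<lambda>j. F (k + j) w * (z - w) ^ j / fact j) sums F k z"
proof -
  have err: "\<bar>F k z - (\<Sum>i\<le>n. F (k + i) w * (z - w) ^ i / fact i)\<bar>
      \<le> M ^ (k + 2) * \<bar>z - w\<bar> * (inverse (fact n) * (M * \<bar>z - w\<bar>) ^ n)" for n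
  proof -
    have "norm (F (k + 0) z - (\<Sum>i\<le>n. F (k + i) w * (z - w) ^ i / fact i))
        \<le> M ^ Suc (k + Suc n) * norm (z - w) ^ Suc n / fact n"
      by (rule field_Taylor[where f = "\<lambda>i. F (k + i)", OF S _ _ w z]) (use F B[of _ "k + Suc n" for n] in auto)
    also have "\<dots> = M ^ (k + 2) * \<bar>z - w\<bar> * (inverse (fact n) * (M * \<bar>z - w\<bar>) ^ n)"
      by (simp add: power_add power_mult_distrib field_simps)
    finally show ?thesis by simp
  qed
  have lim: "(\<lambda>n. M ^ (k + 2) * \<bar>z - w\<bar> * (inverse (fact n) * (M * \<bar>z - w\<bar>) ^ n)) \<longlonglongrightarrow> 0"
    by (intro tendsto_mult_right_zero summable_LIMSEQ_zero summable_exp)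
  have "(\<lambda>n. F k z - (\<Sum>i\<le>n. F (k + i) w * (z - w) ^ i / fact i)) \<longlonglongrightarrow> 0"
    by (rule Lim_null_comparison[OF always_eventually lim]) (use err in \<open>simp only: real_norm_def simp_thms\<close>)
  from tendsto_diff[OF tendsto_const[of "F k z"] this]
  have "(\<lambda>n. \<Sum>i\<le>n. F (k + i) w * (z - w) ^ i / fact i) \<longlonglongrightarrow> F k z" by simp
  then show ?thesis by (simp add: sums_def_le)
qed

text \<open>\<open>M\<close> only ensures that the Taylor series at \<open>w\<close> converges; the
  resulting bound contains nothing but the rate \<open>N\<close> at the single point
  \<open>w\<close>. The Baire argument relies on this disappearance of \<open>M\<close>.\<close>

lemma derivative_bound_propagates:
  fixes F :: "nat \<Rightarrow> real \<Rightarrow> real"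
  assumes S: "convex S"
    and F: "\<And>k x. x \<in> S \<Longrightarrow> (F k has_real_derivative F (Suc k) x) (at x within S)"
    and B: "\<And>k x. x \<in> S \<Longrightarrow> \<bar>F k x\<bar> \<le> M ^ Suc k"
    and w: "w \<in> S" and z: "z \<in> S"
    and N: "\<And>k. \<bar>F k w\<bar> \<le> N ^ Suc k"
  shows "\<bar>F k z\<bar> \<le> N ^ Suc k * exp (N * \<bar>z - w\<bar>)"
proof -
  have g: "(\<lambda>j. N ^ Suc k * ((N * \<bar>z - w\<bar>) ^ j /\<^sub>R fact j)) sums (N ^ Suc k * exp (N * \<bar>z - w\<bar>))"
    by (intro sums_mult exp_converges)
  have f: "(\<lambda>j. F (k + j) w * (z - w) ^ j / fact j) sums F k z"
    by (rule sums_Taylor_uniformly_bounded[OF S F B w z])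
  have "norm (F (k + j) w * (z - w) ^ j / fact j) \<le> N ^ Suc k * ((N * \<bar>z - w\<bar>) ^ j /\<^sub>R fact j)" for j
  proof -
    have "norm (F (k + j) w * (z - w) ^ j / fact j) = \<bar>F (k + j) w\<bar> * (\<bar>z - w\<bar> ^ j / fact j)"
      by (simp add: abs_mult power_abs)
    also have "\<dots> \<le> N ^ Suc (k + j) * (\<bar>z - w\<bar> ^ j / fact j)"
      by (intro mult_right_mono N) auto
    also have "\<dots> = N ^ Suc k * ((N * \<bar>z - w\<bar>) ^ j /\<^sub>R fact j)"
      by (simp add: power_add power_mult_distrib field_simps)
    finally show ?thesis .
  qed
  then have "norm (suminf (\<lambda>j. F (k + j) w * (z - w) ^ j / fact j))
      \<le> suminf (\<lambda>j. N ^ Suc k * ((N * \<bar>z - w\<bar>) ^ j /\<^sub>R fact j))"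
    by (rule norm_suminf_le) (use g in \<open>rule sums_summable\<close>)
  then show ?thesis using sums_unique[OF g] sums_unique[OF f] by simp
qed

text \<open>
  A Pringsheim-Boas type statement: the bound on the derivatives need not be locally uniform in the
  point. By Baire, it is uniform on a portion of the set \<open>E\<close> of points where local uniformity fails;
  on the gaps of \<open>E\<close> the function agrees with its Taylor series at an end point of the gap, so the
  uniform bound extends to a neighbourhood of a point of \<open>E\<close>, a contradiction.
\<close>
theorem sums_Taylor_pointwise_exponential_type:
  fixes F :: "nat \<Rightarrow> real \<Rightarrow> real"
  assumes F0: "\<And>k x. x \<in> {0..<\<delta>} \<Longrightarrow> (F k has_real_derivative F (Suc k) x) (at x within {0..<\<delta>})"
    and B: "\<And>x. x \<in> {0..<\<delta>} \<Longrightarrow> \<exists>M\<ge>0. \<forall>k. \<bar>F k x\<bar> \<le> M ^ Suc k"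
    and T: "T \<in> {0..<\<delta>}"
  shows "(\<lambda>j. F j 0 * T ^ j / fact j) sums F 0 T"
proof -
  \<comment> \<open>The half-open interval is cut off at \<open>T\<close>, since the covering
    argument and the closedness of \<open>E\<close> need a compact interval.\<close>
  define I where "I = {0..T}"
  have I: "I \<subseteq> {0..<\<delta>}" "compact I" "convex I" "closed I" using T by (auto simp: I_def)
  have F: "(F k has_real_derivative F (Suc k) x) (at x within S)" if "x \<in> S" "S \<subseteq> I" for k x S
    using DERIV_subset[OF F0] that I by blast
  have contF: "continuous_on S (F k)" if "S \<subseteq> I" for k S
    using F that by (meson DERIV_continuous_on)
  define bd where "bd M x \<longleftrightarrow> (\<forall>k. \<bar>F k x\<bar> \<le> M ^ Suc k)" for M x
  have bd_mono: "bd M' x" if "bd M x" "0 \<le> M" "M \<le> M'" for M M' x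
    using that unfolding bd_def by (meson order_trans power_mono)
  define G where "G = {x. \<exists>\<epsilon>>0. \<exists>M\<ge>0. \<forall>y\<in>I \<inter> ball x \<epsilon>. bd M y}"
  have "open G"
    unfolding open_contains_ball
  proof
    fix x assume "x \<in> G"
    then obtain e M where e: "e > 0" "M \<ge> 0" "\<And>y. y \<in> I \<inter> ball x e \<Longrightarrow> bd M y" by (auto simp: G_def)
    have "ball x e \<subseteq> G"
    proof
      fix y assume "y \<in> ball x e"
      then obtain e' where "e' > 0" "ball y e' \<subseteq> ball x e" using open_contains_ball open_ball by metis
      then show "y \<in> G" unfolding G_def using e(2,3) by (intro CollectI exI[of _ e'] conjI exI[of _ M]) auto
    qed
    with e show "\<exists>e>0. ball x e \<subseteq> G" by blast
  qed
  define E where "E = I - G"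
  have "closed E" unfolding E_def using \<open>open G\<close> I by auto
  have unif: "\<exists>M\<ge>0. \<forall>y\<in>K. bd M y" if K: "compact K" "K \<subseteq> I" "K \<inter> E = {}" for K
  proof -
    have "\<forall>x\<in>K. \<exists>\<epsilon>>0. \<exists>M\<ge>0. \<forall>y\<in>I \<inter> ball x \<epsilon>. bd M y" using K by (auto simp: E_def G_def)
    then obtain e M where eM: "\<And>x. x \<in> K \<Longrightarrow> e x > 0 \<and> M x \<ge> 0 \<and> (\<forall>y\<in>I \<inter> ball x (e x). bd (M x) y)" by metis
    have "K \<subseteq> (\<Union>x\<in>K. ball x (e x))" using eM by auto
    then obtain C where C: "C \<subseteq> K" "finite C" "K \<subseteq> (\<Union>x\<in>C. ball x (e x))"
      using compactE_image[OF K(1), of K "\<lambda>x. ball x (e x)"] by auto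
    have "bd (sum M C) y" if y: "y \<in> K" for y
    proof -
      obtain x where x: "x \<in> C" "y \<in> ball x (e x)" using C y by blast
      have "bd (M x) y" using x eM C y K by blast
      then show ?thesis by (rule bd_mono) (use x C eM in \<open>auto intro!: member_le_sum\<close>)
    qed
    moreover have "sum M C \<ge> 0" using C eM by (intro sum_nonneg) auto
    ultimately show ?thesis by blast
  qed
  have "E = {}"
  proof (rule ccontr)
    assume "E \<noteq> {}"
    \<comment> \<open>These closed sets cover \<open>E\<close> by the pointwise bounds. If all their
      complements were dense in \<open>E\<close>, Baire would make the empty set dense in
      \<open>E\<close>.\<close>
    define N where "N n = {x \<in> I. bd (real n) x}" for n
    have "closed (N n)" for n
    proof -
      have "N n = I \<inter> (\<Inter>k. {x \<in> I. \<bar>F k x\<bar> \<le> real n ^ Suc k})" by (auto simp: N_def bd_def)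
      moreover have "closed {x \<in> I. \<bar>F k x\<bar> \<le> real n ^ Suc k}" for k
        by (intro continuous_on_closed_Collect_le continuous_intros contF I) auto
      ultimately show ?thesis using I by (simp add: closed_INT closed_Int)
    qed
    have "\<exists>n. \<not> E \<subseteq> closure (E - N n)"
    proof (rule ccontr)
      assume "\<nexists>n. \<not> E \<subseteq> closure (E - N n)"
      then have "E \<subseteq> closure (\<Inter>(range (\<lambda>n. E - N n)))"
      proof (intro Baire \<open>closed E\<close>)
        fix U assume "U \<in> range (\<lambda>n. E - N n)"
        then obtain n where n: "U = E - N n" by auto
        have "openin (top_of_set E) (E \<inter> - N n)"
          by (intro openin_open_Int open_Compl \<open>closed (N n)\<close>)
        then show "openin (top_of_set E) U \<and> E \<subseteq> closure U"
          using n \<open>\<nexists>n. \<not> E \<subseteq> closure (E - N n)\<close> by (simp add: Diff_eq)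
      qed auto
      moreover have "\<Inter>(range (\<lambda>n. E - N n)) = {}"
      proof -
        have "\<exists>n. x \<in> N n" if "x \<in> E" for x
        proof -
          have "x \<in> I" using that by (auto simp: E_def)
          then obtain M where M: "M \<ge> 0" "bd M x" using B I unfolding bd_def by blast
          obtain n where "M \<le> real n" using real_arch_simple by blast
          then show ?thesis using bd_mono M \<open>x \<in> I\<close> by (auto simp: N_def)
        qed
        then show ?thesis by auto
      qed
      ultimately have "E \<subseteq> closure {}" by (simp only:)
      then show False using \<open>E \<noteq> {}\<close> by simp
    qed
    then obtain n c where c: "c \<in> E" "c \<notin> closure (E - N n)" by auto
    then obtain \<epsilon> where \<epsilon>: "\<epsilon> > 0" "ball c \<epsilon> \<inter> (E - N n) = {}"
      using closure_subset[of "E - N n"] open_contains_ball_eq[OF open_Compl[OF closed_closure], of c "E - N n"] by blast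
    have cI: "c \<in> I" using c by (auto simp: E_def)
    \<comment> \<open>Carrying the rate \<open>real n\<close> from a point of \<open>E\<close> over
      a distance at most \<epsilon> costs the factor \<open>exp (real n * \<epsilon>)\<close>; being
      at least 1, it can be moved under the power \<open>Suc k\<close>.\<close>
    define M' where "M' = real n * exp (real n * \<epsilon>)"
    have nM': "real n \<le> M'" unfolding M'_def using \<epsilon> by (simp add: mult_le_cancel_left1)
    have "bd M' x" if x: "x \<in> I" "x \<in> ball c \<epsilon>" for x
    proof (cases "x \<in> E")
      case True
      then have "bd (real n) x" using \<epsilon> x by (auto simp: N_def)
      then show ?thesis using bd_mono nM' by (metis of_nat_0_le_iff)
    next
      case False
      \<comment> \<open>The point \<open>e\<close> of \<open>K\<close> nearest to \<open>x\<close>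
        is the end point of the gap of \<open>E\<close> that contains \<open>x\<close>.\<close>
      define K where "K = E \<inter> closed_segment c x"
      have "closed K" "K \<noteq> {}" using \<open>closed E\<close> c by (auto simp: K_def)
      then obtain e where e: "e \<in> K" "\<And>y. y \<in> K \<Longrightarrow> dist x e \<le> dist x y"
        using distance_attains_inf by metis
      have ec: "e \<in> closed_segment c x" and eE: "e \<in> E" using e by (auto simp: K_def)
      have sub: "closed_segment e x \<subseteq> closed_segment c x" using ec by (simp add: subset_closed_segment)
      have "closed_segment c x \<subseteq> ball c \<epsilon>" using x \<epsilon> by (intro closed_segment_subset) auto
      then have "e \<in> N n" using ec eE \<epsilon> by blast
      then have en: "\<And>k. \<bar>F k e\<bar> \<le> real n ^ Suc k" by (auto simp: N_def bd_def)
      have subI: "closed_segment c x \<subseteq> I" using x cI I by (intro closed_segment_subset) auto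
      have "e \<noteq> x" using False eE by auto
      have noE: "y \<notin> E" if "y \<in> closed_segment e x" "y \<noteq> e" for y
      proof
        assume "y \<in> E"
        then have "dist x e \<le> dist x y" using that sub e by (auto simp: K_def)
        moreover have "dist x y < dist x e" using that
          by (auto simp: closed_segment_eq_real_ivl dist_real_def split: if_splits)
        ultimately show False by simp
      qed
      obtain Mx where Mx: "Mx \<ge> 0" "bd Mx x" using B I x(1) unfolding bd_def by blast
      \<comment> \<open>The bound at \<open>e\<close> cannot be propagated yet, as compactness gives
        uniformity only on segments that avoid \<open>e\<close>. So the bound at \<open>x\<close> is
        first carried towards \<open>e\<close>; it does not depend on \<open>y\<close> and passes to
        the closed segment by continuity. This makes propagation from \<open>e\<close> legitimate,
        and that second step removes \<open>Mx\<close>.\<close>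
      have half: "\<bar>F k y\<bar> \<le> Mx ^ Suc k * exp (Mx * \<bar>x - e\<bar>)" if y: "y \<in> open_segment e x" for k y
      proof -
        have y': "y \<in> closed_segment e x" "y \<noteq> e" using y by (auto simp: open_segment_def)
        have s: "closed_segment y x \<subseteq> closed_segment e x" using y' by (simp add: subset_closed_segment)
        have "e \<notin> closed_segment y x" using y
          by (auto simp: closed_segment_eq_real_ivl open_segment_eq_real_ivl split: if_splits)
        with s noE have "closed_segment y x \<inter> E = {}" by (metis disjoint_iff subsetD)
        then obtain A where A: "A \<ge> 0" "\<forall>y\<in>closed_segment y x. bd A y"
          using unif[OF compact_segment subset_trans[OF s subset_trans[OF sub subI]]] by auto
        have "\<bar>F k y\<bar> \<le> Mx ^ Suc k * exp (Mx * \<bar>y - x\<bar>)"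
          by (rule derivative_bound_propagates[of "closed_segment y x" F A])
             (use A Mx subset_trans[OF s subset_trans[OF sub subI]] in \<open>auto simp: bd_def simp del: power_Suc intro!: F\<close>)
        also have "\<dots> \<le> Mx ^ Suc k * exp (Mx * \<bar>x - e\<bar>)"
          using y' Mx by (intro mult_left_mono) (auto simp: closed_segment_eq_real_ivl intro!: mult_left_mono split: if_splits)
        finally show ?thesis .
      qed
      have cl: "closure (open_segment e x) = closed_segment e x" using \<open>e \<noteq> x\<close> by simp
      define A where "A = Mx * exp (Mx * \<bar>x - e\<bar>)"
      have full: "\<bar>F k y\<bar> \<le> A ^ Suc k" if y: "y \<in> closed_segment e x" for k y
      proof -
        have "\<bar>F k y\<bar> \<le> Mx ^ Suc k * exp (Mx * \<bar>x - e\<bar>)"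
          by (rule continuous_le_on_closure[of "open_segment e x" "\<lambda>y. \<bar>F k y\<bar>"])
             (use half y subset_trans[OF sub subI] \<open>e \<noteq> x\<close> in \<open>auto simp: cl simp del: power_Suc intro!: continuous_intros contF\<close>)
        also have "\<dots> \<le> Mx ^ Suc k * exp (Mx * \<bar>x - e\<bar>) ^ Suc k"
          using Mx self_le_power[of "exp (Mx * \<bar>x - e\<bar>)" "Suc k"] by (intro mult_left_mono) auto
        finally show ?thesis by (simp only: A_def power_mult_distrib)
      qed
      have "\<bar>F k x\<bar> \<le> M' ^ Suc k" for k
      proof -
        have "\<bar>F k x\<bar> \<le> real n ^ Suc k * exp (real n * \<bar>x - e\<bar>)"
          by (rule derivative_bound_propagates[of "closed_segment e x" F A])
             (use full en subset_trans[OF sub subI] in \<open>auto simp del: power_Suc intro!: F\<close>)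
        also have "\<dots> \<le> real n ^ Suc k * exp (real n * \<epsilon>)"
        proof -
          have "\<bar>x - e\<bar> \<le> \<bar>x - c\<bar>" using ec by (auto simp: closed_segment_eq_real_ivl split: if_splits)
          then have "\<bar>x - e\<bar> \<le> \<epsilon>" using x by (auto simp: dist_real_def)
          then show ?thesis by (intro mult_left_mono) (auto intro: mult_left_mono)
        qed
        also have "\<dots> \<le> real n ^ Suc k * exp (real n * \<epsilon>) ^ Suc k"
          using \<epsilon> self_le_power[of "exp (real n * \<epsilon>)" "Suc k"] by (intro mult_left_mono) auto
        finally show ?thesis by (simp only: M'_def power_mult_distrib)
      qed
      then show ?thesis by (simp add: bd_def)
    qed
    moreover have "M' \<ge> 0" using nM' by (meson of_nat_0_le_iff order_trans)
    ultimately have "c \<in> G" using \<epsilon>(1) unfolding G_def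
      by (intro CollectI exI[of _ \<epsilon>] conjI exI[of _ M']) auto
    with c show False by (simp add: E_def)
  qed
  then obtain M where M: "\<forall>y\<in>I. bd M y" using unif[of I] I by auto
  have "(\<lambda>j. F (0 + j) 0 * (T - 0) ^ j / fact j) sums F 0 T"
    by (rule sums_Taylor_uniformly_bounded[OF I(3), of F M]) (use M T in \<open>auto simp: bd_def I_def simp del: power_Suc intro!: F\<close>)
  then show ?thesis by simp
qed

subsection \<open>Moments and their determinants\<close>

text \<open>
  The \<open>k\<close>-th power, applied to \<open>x\<close>, of the matrix with entries \<open>u i\<close> at \<open>(i, i + p)\<close> and \<open>v i\<close> at
  \<open>(i, i - 1)\<close>. With \<open>u = 1\<close> this is \<open>L1\<close> (and \<open>v i = a (i - 1)\<close>); with \<open>v = 1\<close> it is the transpose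
  of \<open>L2\<close> (and \<open>u = b\<close>).
\<close>
fun hess_pow :: "nat \<Rightarrow> (nat \<Rightarrow> complex) \<Rightarrow> (nat \<Rightarrow> complex) \<Rightarrow> (nat \<Rightarrow> complex) \<Rightarrow> nat \<Rightarrow> nat \<Rightarrow> complex" where
  "hess_pow p u v x 0 i = x i"
| "hess_pow p u v x (Suc k) i =
     u i * hess_pow p u v x k (i + p) + (if i = 0 then 0 else v i * hess_pow p u v x k (i - 1))"

definition unit_seq :: "nat \<Rightarrow> nat \<Rightarrow> complex" where
  "unit_seq s i = (if i = s then 1 else 0)"

section \<open>Entries of powers of the two banded matrices\<close>

lemma bpow_eq_0: "i + w * k < j \<Longrightarrow> bpow w M k i j = 0"
  if "\<And>i j. i + w < j \<Longrightarrow> M i j = 0"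
proof (induction k arbitrary: i)
  case (Suc k)
  then show ?case by (auto intro!: sum.neutral)
qed auto

text \<open>\<open>bpow\<close> splits off factors on the left, but the moments of \<open>L2\<close>
  are entries of row 0, whose recursion comes from multiplication on the right. The bandwidth keeps
  all sums finite, so they can be interchanged.\<close>

lemma bpow_Suc_right:
  "bpow w M (Suc k) i j = (\<Sum>l\<le>i + w * k. bpow w M k i l * M l j)"
  if M: "\<And>i j. i + w < j \<Longrightarrow> M i j = 0"
proof (induction k arbitrary: i)
  case 0
  show ?case using M by (auto simp: if_distrib[of "(*) _"] if_distrib[of "\<lambda>x. x * _"] not_le cong: if_cong)
next
  case (Suc k)
  have ext: "bpow w M (Suc k) s j = (\<Sum>l\<le>i + w * Suc k. bpow w M k s l * M l j)" if "s \<le> i + w" for s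
    unfolding Suc.IH
    by (rule sum.mono_neutral_left) (use that bpow_eq_0[of w M s k] M in \<open>auto simp: algebra_simps\<close>)
  have "bpow w M (Suc (Suc k)) i j = (\<Sum>s\<le>i + w. M i s * bpow w M (Suc k) s j)" by simp
  also have "\<dots> = (\<Sum>s\<le>i + w. M i s * (\<Sum>l\<le>i + w * Suc k. bpow w M k s l * M l j))"
    by (intro sum.cong refl arg_cong2[of _ _ _ _ "(*)"] ext) auto
  also have "\<dots> = (\<Sum>l\<le>i + w * Suc k. \<Sum>s\<le>i + w. M i s * (bpow w M k s l * M l j))"
    by (subst sum.swap) (simp add: sum_distrib_left)
  also have "\<dots> = (\<Sum>l\<le>i + w * Suc k. bpow w M (Suc k) i l * M l j)"
    by (simp add: sum_distrib_right mult.assoc)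
  finally show ?case .
qed

lemma bpow_L1:
  "bpow (max r 1) (L1 r a) k i 0 = hess_pow r (\<lambda>_. 1) (\<lambda>i. a (i - 1)) (unit_seq 0) k i"
proof (induction k arbitrary: i)
  case (Suc k)
  let ?f = "bpow (max r 1) (L1 r a) k"
  have "bpow (max r 1) (L1 r a) (Suc k) i 0 =
     (\<Sum>l\<le>i + max r 1. (if l = i + r then ?f l 0 else 0)
        + (if l = i - 1 then if i = 0 then 0 else a (i - 1) * ?f (i - 1) 0 else 0))"
    unfolding bpow.simps by (rule sum.cong) (auto simp: L1_def distrib_right)
  also have "\<dots> = ?f (i + r) 0 + (if i = 0 then 0 else a (i - 1) * ?f (i - 1) 0)"
    by (subst sum.distrib) (auto simp: sum.delta)
  finally show ?case using Suc.IH by auto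
qed (auto simp: unit_seq_def)

lemma bpow_L2:
  assumes "q \<ge> 1"
  shows "bpow 1 (L2 q b) k 0 j = hess_pow q b (\<lambda>_. 1) (unit_seq 0) k j"
proof (induction k arbitrary: j)
  case (Suc k)
  let ?f = "bpow 1 (L2 q b) k 0"
  have L2_0: "L2 q b i j = 0" if "i + 1 < j" for i j using that by (auto simp: L2_def)
  have f0: "?f l = 0" if "k < l" for l using bpow_eq_0[of 1 "L2 q b", OF L2_0, of 0 k l] that by auto
  have "bpow 1 (L2 q b) (Suc k) 0 j =
     (\<Sum>l\<le>k. (if l = j + q then b j * ?f l else 0) + (if l = j - 1 then if j = 0 then 0 else ?f l else 0))"
    by (subst bpow_Suc_right[OF L2_0]) (auto simp: L2_def algebra_simps intro!: sum.cong)
  also have "\<dots> = b j * ?f (j + q) + (if j = 0 then 0 else ?f (j - 1))"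
    using f0 by (subst sum.distrib) (auto simp: sum.delta)
  finally show ?case using Suc.IH by auto
qed (auto simp: unit_seq_def)

section \<open>Triangular factorisation of the moment matrix\<close>

lemma hess_pow_add:
  "hess_pow p u v x (k + j) i = hess_pow p u v (hess_pow p u v x j) k i"
  by (induction k arbitrary: i) auto

lemma hess_pow_unit_seq_eq_0: "i + p * k < s \<Longrightarrow> hess_pow p u v (unit_seq s) k i = 0"
  by (induction k arbitrary: i) (auto simp: unit_seq_def algebra_simps)

text \<open>Each application looks at most \<open>p\<close> indices ahead, so the truncated sum is
  exact. In row \<open>i\<close> of the moment matrix the reach is
  \<open>i mod p + p * (i div p) = i\<close>, which turns the infinite product into one of
  \<open>N\<close> by \<open>N\<close> blocks.\<close>

lemma hess_pow_eq_sum: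
  "i + p * k < n \<Longrightarrow> hess_pow p u v x k i = (\<Sum>s<n. hess_pow p u v (unit_seq s) k i * x s)"
proof (induction k arbitrary: i)
  case 0
  have "(\<Sum>s<n. hess_pow p u v (unit_seq s) 0 i * x s) = (\<Sum>s<n. if s = i then x s else 0)"
    by (rule sum.cong) (auto simp: unit_seq_def)
  then show ?case using 0 by simp
next
  case (Suc k)
  have 1: "hess_pow p u v x k (i + p) = (\<Sum>s<n. hess_pow p u v (unit_seq s) k (i + p) * x s)"
    using Suc by (intro Suc.IH) (auto simp: algebra_simps)
  have 2: "hess_pow p u v x k (i - 1) = (\<Sum>s<n. hess_pow p u v (unit_seq s) k (i - 1) * x s)"
    using Suc by (intro Suc.IH) (auto simp: algebra_simps)
  show ?case
    using 2 by (simp add: 1 sum_distrib_left sum.distrib distrib_right mult.assoc)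
qed

text \<open>A step goes up by \<open>p\<close> or down by 1, so the only path from \<open>i\<close>
  to \<open>i + p * k\<close> in \<open>k\<close> steps goes up throughout.\<close>

lemma hess_pow_unit_seq_top:
  "p \<ge> 1 \<Longrightarrow> hess_pow p u v (unit_seq (i + p * k)) k i = (\<Prod>l<k. u (i + p * l))"
proof (induction k arbitrary: i)
  case (Suc k)
  have "hess_pow p u v (unit_seq (i + p * Suc k)) k (i - 1) = 0"
    using Suc.prems by (intro hess_pow_unit_seq_eq_0) (auto simp: algebra_simps)
  moreover have "hess_pow p u v (unit_seq (i + p * Suc k)) k (i + p) = (\<Prod>l<k. u (i + p + p * l))"
    using Suc.IH[OF Suc.prems, of "i + p"] by (simp add: algebra_simps)
  ultimately show ?case
    by (simp add: prod.lessThan_Suc_shift algebra_simps del: prod.lessThan_Suc)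
qed (auto simp: unit_seq_def)

lemma hess_pow_unit_0_eq_0: "k < i \<Longrightarrow> hess_pow p u v (unit_seq 0) k i = 0"
  by (induction k arbitrary: i) (auto simp: unit_seq_def)

text \<open>Only downward steps lead from \<open>k\<close> to 0 in \<open>k\<close> steps.\<close>

lemma hess_pow_unit_0_diag: "p \<ge> 1 \<Longrightarrow> hess_pow p u v (unit_seq 0) k k = (\<Prod>l=1..k. v l)"
  by (induction k) (auto simp: unit_seq_def hess_pow_unit_0_eq_0)

definition pivot :: "nat \<Rightarrow> (nat \<Rightarrow> complex) \<Rightarrow> (nat \<Rightarrow> complex) \<Rightarrow> nat \<Rightarrow> complex" where
  "pivot p u v n = (\<Prod>l<n div p. u (n mod p + p * l)) * (\<Prod>l=1..n. v l)"

text \<open>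
  The moment matrix is the product of a lower and an upper triangular matrix; \<open>pivot p u v n\<close> is the
  product of their \<open>n\<close>-th diagonal entries.
\<close>
lemma det_moments:
  assumes p: "p \<ge> 1"
  shows "det (mat N N (\<lambda>(i, j). hess_pow p u v (unit_seq 0) (i div p + j) (i mod p))) = (\<Prod>n<N. pivot p u v n)"
proof -
  define A where "A = mat N N (\<lambda>(i, s). hess_pow p u v (unit_seq s) (i div p) (i mod p))"
  define B where "B = mat N N (\<lambda>(s, j). hess_pow p u v (unit_seq 0) j s)"
  have [simp]: "A \<in> carrier_mat N N" "B \<in> carrier_mat N N" by (auto simp: A_def B_def)
  have "mat N N (\<lambda>(i, j). hess_pow p u v (unit_seq 0) (i div p + j) (i mod p)) = A * B"
  proof (rule eq_matI)
    fix i j assume ij: "i < dim_row (A * B)" "j < dim_col (A * B)"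
    then have "i mod p + p * (i div p) < N" by (simp add: A_def)
    then show "mat N N (\<lambda>(i, j). hess_pow p u v (unit_seq 0) (i div p + j) (i mod p)) $$ (i, j) = (A * B) $$ (i, j)"
      using ij hess_pow_eq_sum[of "i mod p" p "i div p" N u v "hess_pow p u v (unit_seq 0) j"]
      by (simp add: hess_pow_add A_def B_def scalar_prod_def atLeast0LessThan)
  qed (auto simp: A_def B_def)
  then have "det (mat N N (\<lambda>(i, j). hess_pow p u v (unit_seq 0) (i div p + j) (i mod p))) = det A * det B"
    by (simp add: det_mult[of _ N])
  also have "det A = (\<Prod>n<N. A $$ (n, n))"
    by (subst det_lower_triangular[of N])
       (auto simp: A_def diag_mat_def prod.list_conv_set_nth atLeast0LessThan intro!: hess_pow_unit_seq_eq_0)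
  also have "det B = (\<Prod>n<N. B $$ (n, n))"
    by (subst det_upper_triangular[of _ N])
       (auto simp: B_def diag_mat_def prod.list_conv_set_nth atLeast0LessThan upper_triangular_def intro!: hess_pow_unit_0_eq_0)
  also have "(\<Prod>n<N. A $$ (n, n)) * (\<Prod>n<N. B $$ (n, n)) = (\<Prod>n<N. pivot p u v n)"
    unfolding prod.distrib[symmetric]
  proof (intro prod.cong refl)
    fix n assume n: "n \<in> {..<N}"
    have "hess_pow p u v (unit_seq n) (n div p) (n mod p) = (\<Prod>l<n div p. u (n mod p + p * l))"
      using hess_pow_unit_seq_top[OF p, of u v "n mod p" "n div p"] by simp
    then show "A $$ (n, n) * B $$ (n, n) = pivot p u v n"
      using n p by (simp add: A_def B_def pivot_def hess_pow_unit_0_diag)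
  qed
  finally show ?thesis .
qed

text \<open>For \<open>v = 1\<close> the quotient of pivots at distance \<open>p\<close> is
  \<open>u n\<close>, which recovers \<open>b\<close>; for \<open>u = 1\<close> consecutive pivots
  suffice to recover \<open>a\<close>.\<close>

lemma pivot_add:
  assumes "p \<ge> 1"
  shows "pivot p u v (n + p) = pivot p u v n * (u n * (\<Prod>l=n + 1..n + p. v l))"
proof -
  have "(\<Prod>l=1..n + p. v l) = (\<Prod>l=1..n. v l) * (\<Prod>l=n + 1..n + p. v l)"
    using prod.ub_add_nat[of 1 n v p] by simp
  then show ?thesis using assms by (simp add: pivot_def div_add_self2 algebra_simps)
qed

lemma pivot_Suc_unit: "pivot p (\<lambda>_. 1) v (Suc n) = pivot p (\<lambda>_. 1) v n * v (Suc n)"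
  by (simp add: pivot_def)

lemma pivot_neq_0: "(\<And>i. u i \<noteq> 0) \<Longrightarrow> (\<And>i. i \<ge> 1 \<Longrightarrow> v i \<noteq> 0) \<Longrightarrow> pivot p u v n \<noteq> 0"
  by (auto simp: pivot_def)

subsection \<open>Evolution of the moments\<close>

lemma sums_Taylor_pointwise_exponential_type_complex:
  fixes F :: "nat \<Rightarrow> real \<Rightarrow> complex"
  assumes F: "\<And>k x. x \<in> {0..<\<delta>} \<Longrightarrow> (F k has_vector_derivative F (Suc k) x) (at x within {0..<\<delta>})"
    and B: "\<And>x. x \<in> {0..<\<delta>} \<Longrightarrow> \<exists>M\<ge>0. \<forall>k. norm (F k x) \<le> M ^ Suc k"
    and t: "t \<in> {0..<\<delta>}"
  shows "(\<lambda>j. F j 0 * of_real (t ^ j / fact j)) sums F 0 t"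
  unfolding sums_complex_iff
proof
  have "(\<lambda>j. Re (F j 0) * t ^ j / fact j) sums Re (F 0 t)"
  proof (rule sums_Taylor_pointwise_exponential_type[where F = "\<lambda>k x. Re (F k x)", OF _ _ t])
    fix x assume x: "x \<in> {0..<\<delta>}"
    show "((\<lambda>x. Re (F k x)) has_real_derivative Re (F (Suc k) x)) (at x within {0..<\<delta>})" for k
      using bounded_linear.has_vector_derivative[OF bounded_linear_Re F[OF x]]
      by (simp add: has_real_derivative_iff_has_vector_derivative)
    show "\<exists>M\<ge>0. \<forall>k. \<bar>Re (F k x)\<bar> \<le> M ^ Suc k"
      using B[OF x] abs_Re_le_cmod order_trans by metis
  qed
  then show "(\<lambda>j. Re (F j 0 * of_real (t ^ j / fact j))) sums Re (F 0 t)"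
    by (simp only: times_complex.sel Re_complex_of_real Im_complex_of_real mult_zero_right diff_zero times_divide_eq_right)
next
  have "(\<lambda>j. Im (F j 0) * t ^ j / fact j) sums Im (F 0 t)"
  proof (rule sums_Taylor_pointwise_exponential_type[where F = "\<lambda>k x. Im (F k x)", OF _ _ t])
    fix x assume x: "x \<in> {0..<\<delta>}"
    show "((\<lambda>x. Im (F k x)) has_real_derivative Im (F (Suc k) x)) (at x within {0..<\<delta>})" for k
      using bounded_linear.has_vector_derivative[OF bounded_linear_Im F[OF x]]
      by (simp add: has_real_derivative_iff_has_vector_derivative)
    show "\<exists>M\<ge>0. \<forall>k. \<bar>Im (F k x)\<bar> \<le> M ^ Suc k"
      using B[OF x] abs_Im_le_cmod order_trans by metis
  qed
  then show "(\<lambda>j. Im (F j 0 * of_real (t ^ j / fact j))) sums Im (F 0 t)"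
    by (simp only: times_complex.sel Re_complex_of_real Im_complex_of_real mult_zero_right add_0 times_divide_eq_right)
qed

section \<open>Scalar linear equations on a half-open interval\<close>

lemma antiderivative_half_open:
  fixes g :: "real \<Rightarrow> complex"
  assumes g: "continuous_on {0..<\<delta>} g"
  shows "\<exists>G. G 0 = 0 \<and> (\<forall>t\<in>{0..<\<delta>}. (G has_vector_derivative g t) (at t within {0..<\<delta>}))"
proof -
  define G where "G t = integral {0..t} g" for t
  have "(G has_vector_derivative g t) (at t within {0..<\<delta>})" if t: "t \<in> {0..<\<delta>}" for t
  proof -
    \<comment> \<open>A compact interval reaching strictly beyond \<open>t\<close> induces the same
      filter at \<open>t\<close> as the half-open one.\<close>
    define T where "T = (t + \<delta>) / 2"
    have T: "t < T" "T < \<delta>" using t by (auto simp: T_def)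
    have "(G has_vector_derivative g t) (at t within {0..T})"
      unfolding G_def
      by (rule integral_has_vector_derivative) (use t T in \<open>auto intro: continuous_on_subset[OF g]\<close>)
    moreover have "at t within {0..<\<delta>} = at t within {0..T}"
      by (rule at_within_nhd[of _ "{..<T}"]) (use t T in auto)
    ultimately show ?thesis by simp
  qed
  moreover have "G 0 = 0" by (simp add: G_def)
  ultimately show ?thesis by blast
qed

lemma has_vector_derivative_exp_comp:
  fixes G :: "real \<Rightarrow> complex"
  assumes "(G has_vector_derivative g) (at t within S)"
  shows "((\<lambda>s. exp (G s)) has_vector_derivative g * exp (G t)) (at t within S)"
  using field_vector_diff_chain_within[OF assms, of exp "exp (G t)"]
  by (simp add: o_def has_field_derivative_at_within)

text \<open>Multiplication by the integrating factor gives a constant. The existence proofs use both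
  the explicit value and the fact that the exponential form preserves a nonzero initial
  value.\<close>

lemma linear_ode_solution:
  fixes f g G :: "real \<Rightarrow> complex"
  assumes f: "\<And>t. t \<in> {0..<\<delta>} \<Longrightarrow> (f has_vector_derivative f t * g t) (at t within {0..<\<delta>})"
    and G: "\<And>t. t \<in> {0..<\<delta>} \<Longrightarrow> (G has_vector_derivative g t) (at t within {0..<\<delta>})"
    and G0: "G 0 = 0" and t: "t \<in> {0..<\<delta>}"
  shows "f t = f 0 * exp (G t)"
proof -
  have "((\<lambda>s. f s * exp (- G s)) has_vector_derivative 0) (at s within {0..<\<delta>})" if "s \<in> {0..<\<delta>}" for s
    using has_vector_derivative_mult[OF f[OF that] has_vector_derivative_exp_comp[OF has_vector_derivative_minus[OF G[OF that]]]]
    by (simp add: algebra_simps)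
  then obtain c where "\<And>s. s \<in> {0..<\<delta>} \<Longrightarrow> f s * exp (- G s) = c"
    by (rule has_vector_derivative_zero_constant[rotated]) auto
  from this[OF t] this[of 0] t G0 have "f t * exp (- G t) = f 0" by auto
  then show ?thesis by (auto simp: exp_minus field_simps)
qed

text \<open>A path to 0 that goes up even once needs more than \<open>p\<close> steps, so up to
  power \<open>p\<close> only downward paths count. This settles the base case of the evolution and
  the denominators of the second system.\<close>

lemma hess_pow_unit_0_low:
  "k \<le> p \<Longrightarrow> hess_pow p u v (unit_seq 0) k i = (if i = k then \<Prod>l=1..k. v l else 0)"
proof (induction k arbitrary: i)
  case (Suc k)
  then show ?case by (cases i) auto
qed (auto simp: unit_seq_def)

lemma norm_hess_pow_le:
  assumes "\<And>i. norm (u i) \<le> C" "\<And>i. norm (v i) \<le> C"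
  shows "norm (hess_pow p u v (unit_seq 0) k i) \<le> (2 * C) ^ k"
proof (induction k arbitrary: i)
  case (Suc k)
  have C: "0 \<le> C" using assms(1)[of 0] norm_ge_zero order_trans by blast
  let ?z = "hess_pow p u v (unit_seq 0) k"
  have "norm (hess_pow p u v (unit_seq 0) (Suc k) i)
      \<le> norm (u i * ?z (i + p)) + norm (if i = 0 then 0 else v i * ?z (i - 1))"
    unfolding hess_pow.simps by (rule norm_triangle_ineq)
  also have "norm (u i * ?z (i + p)) \<le> C * (2 * C) ^ k"
    unfolding norm_mult using assms C Suc by (intro mult_mono) auto
  also have "norm (if i = 0 then 0 else v i * ?z (i - 1)) \<le> C * (2 * C) ^ k"
    using assms C Suc by (auto simp: norm_mult intro!: mult_mono)
  finally show ?case by (simp only: power_Suc mult_2 distrib_right)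
qed (auto simp: unit_seq_def)

text \<open>
  The hypotheses say that \<open>L' = L A - A L\<close>, where \<open>A\<close> has diagonal \<open>d\<close> and the lowest diagonal of
  \<open>L ^ (p + 1)\<close>. The freedom in \<open>d\<close> covers both systems: \<open>d\<close> is constant when \<open>u = 1\<close>, and a
  running sum of \<open>b\<close> when \<open>v = 1\<close>.
\<close>
lemma hess_pow_has_vector_derivative:
  fixes u v d :: "real \<Rightarrow> nat \<Rightarrow> complex" and p :: nat
  defines "\<beta> \<equiv> \<lambda>t i. u t i * (\<Prod>l=i + 1..i + p. v t l)"
    and "z \<equiv> \<lambda>t. hess_pow p (u t) (v t) (unit_seq 0)"
  assumes p: "p \<ge> 1"
    and u: "\<And>i. ((\<lambda>s. u s i) has_vector_derivative u t i * (d t (i + p) - d t i)) (at t within S)"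
    and v: "\<And>i. i \<ge> 1 \<Longrightarrow> ((\<lambda>s. v s i) has_vector_derivative
        v t i * (d t (i - 1) - d t i + \<beta> t i - (if i > p then \<beta> t (i - p - 1) else 0))) (at t within S)"
    and d0: "d t 0 = \<beta> t 0"
  shows "((\<lambda>s. z s k i) has_vector_derivative
      z t (k + p + 1) i - d t i * z t k i
        - (if i > p then (\<Prod>l=i - p..i. v t l) * z t k (i - p - 1) else 0)) (at t within S)"
proof (induction k arbitrary: i)
  case 0
  \<comment> \<open>The unit vector is constant in time, so the right-hand side must vanish. Power
    \<open>p + 1\<close> is the first with an upward step: its entry at 0 is
    \<open>\<beta> t 0\<close>, matched by \<open>d t 0\<close>, and its entry at
    \<open>p + 1\<close> is the lowest diagonal.\<close>
  have "z t (p + 1) i = d t i * z t 0 i + (if i > p then (\<Prod>l=i - p..i. v t l) * z t 0 (i - p - 1) else 0)"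
  proof -
    consider "i = 0" | "0 < i" "i \<le> p" | "i = p + 1" | "i > p + 1" by linarith
    then show ?thesis
      by cases (use p d0 in \<open>auto simp: z_def hess_pow_unit_0_low unit_seq_def \<beta>_def mult.commute\<close>)
  qed
  then show ?case by (simp add: z_def)
next
  case (Suc k)
  define D where "D i = z t (k + p + 1) i - d t i * z t k i
        - (if i > p then (\<Prod>l=i - p..i. v t l) * z t k (i - p - 1) else 0)" for i
  have IH: "((\<lambda>s. z s k i) has_vector_derivative D i) (at t within S)" for i
    unfolding D_def by (rule Suc)
  have zS: "z s (Suc k) i = u s i * z s k (i + p) + (if i = 0 then 0 else v s i * z s k (i - 1))" for s i k
    by (simp add: z_def)
  \<comment> \<open>The lowest-diagonal term arriving through \<open>u\<close> cancels against
    \<open>\<beta> t i\<close> in the equation for \<open>v\<close>. This is the only relation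
    between the coefficients that the induction step needs.\<close>
  have V: "u t i * (\<Prod>l=i..i + p. v t l) = v t i * \<beta> t i" for i
    by (simp add: \<beta>_def prod.atLeast_Suc_atMost)
  have alg: "U * (z1 - d1 * x - P * y) + U * (d1 - d0) * x + (V * (z2 - d2 * y - Y) + V * (d2 - d0 + B - b) * y)
      = U * z1 + V * z2 - d0 * (U * x + V * y) - (V * b * y + V * Y)" if "U * P = V * B"
    for U V P B z1 z2 d0 d1 d2 x y Y b :: complex
  proof -
    have "U * (z1 - d1 * x - P * y) + U * (d1 - d0) * x + (V * (z2 - d2 * y - Y) + V * (d2 - d0 + B - b) * y)
      = U * z1 + V * z2 - d0 * (U * x + V * y) - (V * b * y + V * Y) - (U * P - V * B) * y"
      by (simp add: algebra_simps)
    then show ?thesis using that by simp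
  qed
  have du: "((\<lambda>s. u s i * z s k (i + p)) has_vector_derivative
      u t i * D (i + p) + u t i * (d t (i + p) - d t i) * z t k (i + p)) (at t within S)"
    by (rule has_vector_derivative_mult[OF u IH])
  show ?case
  proof (cases "i = 0")
    case True
    have "((\<lambda>s. z s (Suc k) i) has_vector_derivative
        u t i * D (i + p) + u t i * (d t (i + p) - d t i) * z t k (i + p)) (at t within S)"
      using du True by (simp add: zS)
    then show ?thesis using True by (simp add: D_def zS algebra_simps)
  next
    case False
    then have i: "i \<ge> 1" by simp
    define y where "y = (if i > p then \<beta> t (i - p - 1) else 0)"
    have dv: "((\<lambda>s. v s i * z s k (i - 1)) has_vector_derivative
        v t i * D (i - 1) + v t i * (d t (i - 1) - d t i + \<beta> t i - y) * z t k (i - 1)) (at t within S)"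
      unfolding y_def by (rule has_vector_derivative_mult[OF v[OF i] IH])
    have der: "((\<lambda>s. z s (Suc k) i) has_vector_derivative
        (u t i * D (i + p) + u t i * (d t (i + p) - d t i) * z t k (i + p)) +
        (v t i * D (i - 1) + v t i * (d t (i - 1) - d t i + \<beta> t i - y) * z t k (i - 1))) (at t within S)"
      using has_vector_derivative_add[OF du dv] False by (simp add: zS)
    have D1: "D (i + p) = z t (k + p + 1) (i + p) - d t (i + p) * z t k (i + p) - (\<Prod>l=i..i + p. v t l) * z t k (i - 1)"
      using i by (simp add: D_def)
    define Y where "Y = (if i - 1 > p then (\<Prod>l=i - 1 - p..i - 1. v t l) * z t k (i - 1 - p - 1) else 0)"
    have D2: "D (i - 1) = z t (k + p + 1) (i - 1) - d t (i - 1) * z t k (i - 1) - Y"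
      by (simp add: D_def Y_def)
    \<comment> \<open>The lowest diagonal in row \<open>i\<close> splits according to the last
      recursion step: the upward part is the remaining term of the equation for \<open>v\<close>,
      the downward part comes from row \<open>i - 1\<close>. Row \<open>n = 0\<close> has no
      downward part.\<close>
    have bulk: "(if i > p then (\<Prod>l=i - p..i. v t l) * z t (Suc k) (i - p - 1) else 0) = v t i * y * z t k (i - 1) + v t i * Y"
    proof (cases "i > p")
      case True
      define n where "n = i - p - 1"
      have n: "i = n + p + 1" using True by (simp add: n_def)
      have P: "(\<Prod>l=i - p..i. v t l) = (\<Prod>l=n + 1..n + p. v t l) * v t i"
        using prod.cl_ivl_Suc[of "v t" "n + 1" "n + p"] n by simp
      have Q: "n > 0 \<Longrightarrow> (\<Prod>l=n..n + p. v t l) = v t n * (\<Prod>l=n + 1..n + p. v t l)"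
        by (simp add: prod.atLeast_Suc_atMost)
      show ?thesis unfolding P
        using Q by (cases "n = 0") (auto simp: n y_def Y_def zS \<beta>_def algebra_simps)
    qed (auto simp: y_def Y_def)
    have z2: "z t (Suc k + p + 1) i = u t i * z t (k + p + 1) (i + p) + v t i * z t (k + p + 1) (i - 1)"
      using False by (simp add: zS)
    have z1: "z t (Suc k) i = u t i * z t k (i + p) + v t i * z t k (i - 1)"
      using False by (simp add: zS)
    have "(u t i * D (i + p) + u t i * (d t (i + p) - d t i) * z t k (i + p)) +
        (v t i * D (i - 1) + v t i * (d t (i - 1) - d t i + \<beta> t i - y) * z t k (i - 1))
      = z t (Suc k + p + 1) i - d t i * z t (Suc k) i - (v t i * y * z t k (i - 1) + v t i * Y)"
      unfolding z1 z2 D1 D2 by (rule alg[OF V])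
    with der show ?thesis unfolding bulk by simp
  qed
qed

text \<open>For \<open>i \<le> p\<close> the lowest-diagonal term is absent, so it suffices that
  \<open>G\<close> integrates the one entry \<open>d t i\<close>.\<close>

lemma moment_sums:
  fixes u v d :: "real \<Rightarrow> nat \<Rightarrow> complex" and p :: nat
  defines "\<beta> \<equiv> \<lambda>t i. u t i * (\<Prod>l=i + 1..i + p. v t l)"
    and "z \<equiv> \<lambda>t. hess_pow p (u t) (v t) (unit_seq 0)"
  assumes p: "p \<ge> 1"
    and u: "\<And>t i. t \<in> {0..<\<delta>} \<Longrightarrow> ((\<lambda>s. u s i) has_vector_derivative u t i * (d t (i + p) - d t i)) (at t within {0..<\<delta>})"
    and v: "\<And>t i. t \<in> {0..<\<delta>} \<Longrightarrow> i \<ge> 1 \<Longrightarrow> ((\<lambda>s. v s i) has_vector_derivative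
        v t i * (d t (i - 1) - d t i + \<beta> t i - (if i > p then \<beta> t (i - p - 1) else 0))) (at t within {0..<\<delta>})"
    and d0: "\<And>t. t \<in> {0..<\<delta>} \<Longrightarrow> d t 0 = \<beta> t 0"
    and bu: "\<And>t. t \<in> {0..<\<delta>} \<Longrightarrow> \<exists>C. \<forall>i. norm (u t i) \<le> C"
    and bv: "\<And>t. t \<in> {0..<\<delta>} \<Longrightarrow> \<exists>C. \<forall>i. norm (v t i) \<le> C"
    and G0: "G 0 = 0"
    and G: "\<And>t. t \<in> {0..<\<delta>} \<Longrightarrow> (G has_vector_derivative d t i) (at t within {0..<\<delta>})"
    and i: "i \<le> p" and t: "t \<in> {0..<\<delta>}"
  shows "(\<lambda>l. z 0 (k + (p + 1) * l) i * of_real (t ^ l / fact l)) sums (z t k i * exp (G t))"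
proof -
  define F where "F l t = z t (k + (p + 1) * l) i * exp (G t)" for l t
  have "(\<lambda>l. F l 0 * of_real (t ^ l / fact l)) sums F 0 t"
  proof (rule sums_Taylor_pointwise_exponential_type_complex[OF _ _ t])
    fix x assume x: "x \<in> {0..<\<delta>}"
    show "(F l has_vector_derivative F (Suc l) x) (at x within {0..<\<delta>})" for l
    proof -
      have "((\<lambda>s. z s (k + (p + 1) * l) i) has_vector_derivative
          z x (k + (p + 1) * l + p + 1) i - d x i * z x (k + (p + 1) * l) i) (at x within {0..<\<delta>})"
        using hess_pow_has_vector_derivative[where t = x and S = "{0..<\<delta>}" and u = u and v = v and d = d
            and k = "k + (p + 1) * l" and i = i, OF p u[OF x]]
          v[OF x] d0[OF x] i
        unfolding z_def \<beta>_def by simp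
      from has_vector_derivative_mult[OF this has_vector_derivative_exp_comp[OF G[OF x]]]
      show ?thesis by (simp add: F_def[abs_def] algebra_simps)
    qed
    obtain C1 C2 where C12: "\<And>i. norm (u x i) \<le> C1" "\<And>i. norm (v x i) \<le> C2" using bu[OF x] bv[OF x] by metis
    define C where "C = max C1 C2"
    have C: "\<And>i. norm (u x i) \<le> C" "\<And>i. norm (v x i) \<le> C" using C12 by (auto simp: C_def max.coboundedI1 max.coboundedI2)
    have C0: "C \<ge> 0" using C(1)[of 0] norm_ge_zero order_trans by blast
    \<comment> \<open>The prefactor and the growth per shift by \<open>p + 1\<close> indices are
      merged into one constant, giving the form \<open>M ^ Suc l\<close>.\<close>
    define M where "M = max ((2 * C) ^ k * norm (exp (G x))) ((2 * C) ^ (p + 1))"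
    have "0 \<le> (2 * C) ^ k * norm (exp (G x))" using C0 by simp
    then have M0: "M \<ge> 0" unfolding M_def by (rule max.coboundedI1)
    have "norm (F l x) \<le> M ^ Suc l" for l
    proof -
      have "norm (F l x) \<le> (2 * C) ^ (k + (p + 1) * l) * norm (exp (G x))"
        unfolding F_def norm_mult z_def by (intro mult_right_mono norm_hess_pow_le C) auto
      also have "\<dots> = ((2 * C) ^ k * norm (exp (G x))) * ((2 * C) ^ (p + 1)) ^ l"
        by (simp only: power_add[of _ k] power_mult mult.assoc mult.left_commute[of _ "norm _"] mult.commute[of _ "norm _"])
      also have "\<dots> \<le> M * M ^ l"
        using C0 M0 by (intro mult_mono power_mono) (auto simp: M_def)
      finally show ?thesis by simp
    qed
    with M0 show "\<exists>M\<ge>0. \<forall>l. norm (F l x) \<le> M ^ Suc l" by blast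
  qed
  then show ?thesis by (simp add: F_def G0)
qed

subsection \<open>Moments of solutions\<close>

lemma prod_ext0_right: "(\<Prod>j=1..r. ext0 a (int i + int j)) = (\<Prod>l=i + 1..i + r. a l)"
  using prod.shift_bounds_cl_nat_ivl[of a 1 i r]
  by (auto simp: ext0_def nat_add_distrib add.commute intro!: prod.cong)

lemma prod_ext0_left:
  "(\<Prod>j=1..r. ext0 a (int i - int j)) = (if r \<le> i then \<Prod>l=i - r..<i. a l else 0)"
proof (cases "r \<le> i")
  case True
  have "(\<Prod>l=i - r..<i. a l) = (\<Prod>j=1..r. a (i - j))"
    by (rule prod.reindex_bij_witness[of _ "\<lambda>j. i - j" "\<lambda>l. i - l"]) (use True in auto)
  also have "\<dots> = (\<Prod>j=1..r. ext0 a (int i - int j))"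
    using True by (auto simp: ext0_def nat_diff_distrib intro!: prod.cong)
  finally show ?thesis using True by simp
next
  case False
  then have "ext0 a (int i - int (i + 1)) = 0" "i + 1 \<in> {1..r}" by (auto simp: ext0_def)
  then show ?thesis using False by (metis prod_zero finite_atLeastAtMost)
qed

lemma continuous_on_ext0:
  "(\<And>i. continuous_on S (\<lambda>t. b t i)) \<Longrightarrow> continuous_on S (\<lambda>t. ext0 (b t) l)"
  by (cases "l < 0") (auto simp: ext0_def)

text \<open>One \<open>E\<close> serves all \<open>m\<close> because \<open>d\<close> does not
  depend on the row here; hence the single denominator with \<open>m = 1\<close> normalises every
  moment.\<close>

lemma sol1_moment_sums:
  assumes r: "r \<ge> 1" and sol: "sol1 r \<delta> a0 a"
  obtains E where "\<And>t. E t \<noteq> 0"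
    "\<And>t m k. t \<in> {0..<\<delta>} \<Longrightarrow> 1 \<le> m \<Longrightarrow> m \<le> r \<Longrightarrow>
       S1_num r a0 m k t sums (hess_pow r (\<lambda>_. 1) (\<lambda>i. a t (i - 1)) (unit_seq 0) k (m - 1) * E t)"
proof -
  let ?I = "{0..<\<delta>}"
  \<comment> \<open>The factor 1 stands for \<open>u\<close>, and \<open>l - 1\<close> comes from
    \<open>v i = a (i - 1)\<close>; the product thus runs over \<open>a\<close> at
    \<open>i..<i + r\<close>.\<close>
  define \<beta> where "\<beta> t i = 1 * (\<Prod>l=i + 1..i + r. a t (l - 1))" for t i
  have a0: "a 0 = a0" using sol by (simp add: sol1_def)
  have da: "((\<lambda>s. a s i) has_vector_derivative a t i * ((\<Prod>l=i + 1..i + r. a t l) - (if r \<le> i then \<Prod>l=i - r..<i. a t l else 0)))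
      (at t within ?I)" if "t \<in> ?I" for t i
    using sol that unfolding sol1_def prod_ext0_right prod_ext0_left by blast
  have \<beta>: "\<beta> t i = (\<Prod>l=i..<i + r. a t l)" for t i
  proof -
    have "(\<Prod>l=i..<i + r. a t l) = (\<Prod>l=Suc i..<Suc (i + r). a t (l - 1))"
      by (subst prod.shift_bounds_Suc_ivl) simp
    then show ?thesis by (simp only: \<beta>_def mult_1 atLeastLessThanSuc_atLeastAtMost Suc_eq_plus1[symmetric])
  qed
  have dv: "((\<lambda>s. a s (i - 1)) has_vector_derivative a t (i - 1) * (\<beta> t i - (if i > r then \<beta> t (i - r - 1) else 0))) (at t within ?I)"
    if t: "t \<in> ?I" and i: "1 \<le> i" for t i
  proof -
    have "(\<Prod>l=i - 1 + 1..i - 1 + r. a t l) = \<beta> t i"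
      unfolding \<beta> using i r by (intro prod.cong) auto
    moreover have "(if r \<le> i - 1 then \<Prod>l=i - 1 - r..<i - 1. a t l else 0) = (if i > r then \<beta> t (i - r - 1) else 0)"
      unfolding \<beta> using i by (auto intro!: prod.cong)
    ultimately show ?thesis using da[OF t, of "i - 1"] by (simp only:)
  qed
  have "continuous_on ?I (\<lambda>t. a t i)" for i
    by (rule continuous_on_vector_derivative[OF da])
  then have "continuous_on ?I (\<lambda>t. \<beta> t 0)" unfolding \<beta>_def by (intro continuous_intros) auto
  from antiderivative_half_open[OF this] obtain G where G: "G 0 = 0"
    "\<And>t. t \<in> ?I \<Longrightarrow> (G has_vector_derivative \<beta> t 0) (at t within ?I)" by blast
  show thesis
  proof (rule that[of "\<lambda>t. exp (G t)"])
    fix t m k assume t: "t \<in> ?I" and m: "1 \<le> m" "m \<le> r"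
    have "(\<lambda>l. hess_pow r (\<lambda>_. 1) (\<lambda>i. a 0 (i - 1)) (unit_seq 0) (k + (r + 1) * l) (m - 1) * of_real (t ^ l / fact l))
        sums (hess_pow r (\<lambda>_. 1) (\<lambda>i. a t (i - 1)) (unit_seq 0) k (m - 1) * exp (G t))"
    proof (rule moment_sums[where p = r and \<delta> = \<delta> and u = "\<lambda>_ _. 1" and v = "\<lambda>t i. a t (i - 1)"
          and d = "\<lambda>t _. \<beta> t 0" and G = G and i = "m - 1" and t = t and k = k])
      show "((\<lambda>s. a s (i - 1)) has_vector_derivative a t (i - 1) * (\<beta> t 0 - \<beta> t 0 + 1 * (\<Prod>l=i + 1..i + r. a t (l - 1)) -
            (if r < i then 1 * (\<Prod>l=i - r - 1 + 1..i - r - 1 + r. a t (l - 1)) else 0))) (at t within ?I)"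
        if t: "t \<in> ?I" and i: "1 \<le> i" for t i
        using dv[OF t i] unfolding \<beta>_def by simp
      show "\<exists>C. \<forall>i. norm (a t (i - 1)) \<le> C" if "t \<in> ?I" for t
        using that sol unfolding sol1_def by blast
    qed (use r m t G in \<open>auto simp: \<beta>_def\<close>)
    then show "S1_num r a0 m k t sums (hess_pow r (\<lambda>_. 1) (\<lambda>i. a t (i - 1)) (unit_seq 0) k (m - 1) * exp (G t))"
      by (simp only: S1_num_def[abs_def] S1_0_def bpow_L1 a0)
  qed auto
qed

lemma S1_den_eq_S1_num: "S1_den r a t = S1_num r a 1 0 t"
  by (auto simp: S1_den_def S1_num_def)

lemma sol1_moments:
  assumes r: "r \<ge> 1" and sol: "sol1 r \<delta> a0 a" and t: "t \<in> {0..<\<delta>}" and m: "1 \<le> m" "m \<le> r"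
  shows "summable (S1_num r a0 m k t)" "summable (S1_den r a0 t)" "suminf (S1_den r a0 t) \<noteq> 0"
    "S1 r a0 m k t = hess_pow r (\<lambda>_. 1) (\<lambda>i. a t (i - 1)) (unit_seq 0) k (m - 1)"
proof -
  from sol1_moment_sums[OF r sol] obtain E where E: "\<And>t. E t \<noteq> 0"
    "\<And>t m k. t \<in> {0..<\<delta>} \<Longrightarrow> 1 \<le> m \<Longrightarrow> m \<le> r \<Longrightarrow>
       S1_num r a0 m k t sums (hess_pow r (\<lambda>_. 1) (\<lambda>i. a t (i - 1)) (unit_seq 0) k (m - 1) * E t)" by blast
  have num: "S1_num r a0 m k t sums (hess_pow r (\<lambda>_. 1) (\<lambda>i. a t (i - 1)) (unit_seq 0) k (m - 1) * E t)"
    by (rule E(2)[OF t m])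
  have den: "S1_den r a0 t sums E t"
    using E(2)[OF t order_refl r, of 0] by (simp add: S1_den_eq_S1_num unit_seq_def)
  show "summable (S1_num r a0 m k t)" "summable (S1_den r a0 t)" "suminf (S1_den r a0 t) \<noteq> 0"
    "S1 r a0 m k t = hess_pow r (\<lambda>_. 1) (\<lambda>i. a t (i - 1)) (unit_seq 0) k (m - 1)"
    using num den E(1) by (auto simp: S1_def sums_iff)
qed

text \<open>The determinants are partial products of pivots, so this second-order quotient is a
  ratio of consecutive pivots. As only \<open>a0\<close> and \<open>t\<close> occur on the right,
  uniqueness is included.\<close>

lemma sol1_formula:
  assumes r: "r \<ge> 1" and sol: "sol1 r \<delta> a0 a" and t: "t \<in> {0..<\<delta>}"
  shows "a t i = D1 r a0 t (i + 2) * D1 r a0 t i / (D1 r a0 t (i + 1))\<^sup>2"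
proof -
  let ?g = "pivot r (\<lambda>_. 1) (\<lambda>i. a t (i - 1))"
  have "D1 r a0 t N = (\<Prod>n<N. ?g n)" for N
  proof -
    have "S1 r a0 (i mod r + 1) k t = hess_pow r (\<lambda>_. 1) (\<lambda>i. a t (i - 1)) (unit_seq 0) k (i mod r)" for i k
      using sol1_moments(4)[OF r sol t, of "i mod r + 1" k] r by (simp add: Suc_le_eq)
    then show ?thesis unfolding D1_def by (simp add: det_moments[OF r])
  qed
  moreover have "?g n \<noteq> 0" for n using sol t by (intro pivot_neq_0) (auto simp: sol1_def)
  moreover have "?g (Suc i) = ?g i * a t i" by (simp add: pivot_Suc_unit)
  ultimately show ?thesis by (simp add: power2_eq_square)
qed

text \<open>Here \<open>d\<close> is the window sum \<open>b (i - q) + ... + b i\<close>. The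
  windows ending at \<open>i + q\<close> and at \<open>i\<close> share just \<open>b i\<close>,
  which cancels and leaves the right-hand side of the system.\<close>

lemma sum_ext0_diff:
  "(\<Sum>j\<le>q. ext0 b (int (i + q) - int j)) - (\<Sum>j\<le>q. ext0 b (int i - int j))
     = (\<Sum>j=1..q. ext0 b (int i + int j)) - (\<Sum>j=1..q. ext0 b (int i - int j))"
proof -
  have "(\<Sum>j\<le>q. ext0 b (int (i + q) - int j)) = (\<Sum>j\<le>q. ext0 b (int i + int j))"
    by (rule sum.reindex_bij_witness[of _ "\<lambda>j. q - j" "\<lambda>j. q - j"]) (auto simp: of_nat_diff algebra_simps)
  also have "\<dots> = ext0 b (int i) + (\<Sum>j=1..q. ext0 b (int i + int j))"
    by (simp add: sum.atLeast_Suc_atMost flip: atLeast0AtMost)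
  moreover have "(\<Sum>j\<le>q. ext0 b (int i - int j)) = ext0 b (int i) + (\<Sum>j=1..q. ext0 b (int i - int j))"
    by (simp add: sum.atLeast_Suc_atMost flip: atLeast0AtMost)
  ultimately show ?thesis by simp
qed

text \<open>Since \<open>v = 1\<close>, its equation must have right-hand side 0. Neighbouring
  windows differ only in their end points, which are exactly the \<beta> terms.\<close>

lemma sum_ext0_step:
  assumes "1 \<le> i"
  shows "(\<Sum>j\<le>q. ext0 b (int (i - 1) - int j)) - (\<Sum>j\<le>q. ext0 b (int i - int j))
     + b i - (if i > q then b (i - q - 1) else 0) = 0"
proof -
  have "(\<Sum>j\<le>q. ext0 b (int i - int j)) - (\<Sum>j\<le>q. ext0 b (int (i - 1) - int j))
      = (\<Sum>j\<le>q. ext0 b (int i - int j) - ext0 b (int i - int (Suc j)))"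
    unfolding sum_subtractf using assms by (simp add: of_nat_diff algebra_simps)
  also have "\<dots> = ext0 b (int i) - ext0 b (int i - int (Suc q))"
    by (subst sum_telescope) simp
  also have "\<dots> = b i - (if i > q then b (i - q - 1) else 0)"
    by (auto simp: ext0_def nat_diff_distrib nat_add_distrib)
  finally show ?thesis by (simp add: algebra_simps)
qed

lemma sol2_continuous:
  assumes sol: "sol2 q \<delta> b0 b"
  shows "continuous_on {0..<\<delta>} (\<lambda>t. b t i)"
  by (rule continuous_on_vector_derivative) (use sol in \<open>unfold sol2_def, blast\<close>)

text \<open>\<open>n\<close> is fixed before \<open>E\<close> is obtained: the exponent integrates
  \<open>d t (n - 1)\<close>, so every \<open>n\<close> has its own denominator.\<close>

lemma sol2_moment_sums:
  assumes q: "q \<ge> 1" and sol: "sol2 q \<delta> b0 b" and n: "1 \<le> n" "n \<le> q"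
  obtains E where "\<And>t. E t \<noteq> 0"
    "\<And>t k. t \<in> {0..<\<delta>} \<Longrightarrow>
       S2_num q b0 n k t sums (hess_pow q (b t) (\<lambda>_. 1) (unit_seq 0) k (n - 1) * E t)"
proof -
  let ?I = "{0..<\<delta>}"
  define d where "d t i = (\<Sum>j\<le>q. ext0 (b t) (int i - int j))" for t and i :: nat
  have b0: "b 0 = b0" using sol by (simp add: sol2_def)
  have "continuous_on ?I (\<lambda>t. d t (n - 1))"
    unfolding d_def by (intro continuous_intros continuous_on_ext0 sol2_continuous[OF sol])
  from antiderivative_half_open[OF this] obtain G where G: "G 0 = 0"
    "\<And>t. t \<in> ?I \<Longrightarrow> (G has_vector_derivative d t (n - 1)) (at t within ?I)" by blast
  show thesis
  proof (rule that[of "\<lambda>t. exp (G t)"])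
    fix t k assume t: "t \<in> ?I"
    have "(\<lambda>l. hess_pow q (b 0) (\<lambda>_. 1) (unit_seq 0) (k + (q + 1) * l) (n - 1) * of_real (t ^ l / fact l))
        sums (hess_pow q (b t) (\<lambda>_. 1) (unit_seq 0) k (n - 1) * exp (G t))"
    proof (rule moment_sums[where p = q and \<delta> = \<delta> and u = b and v = "\<lambda>_ _. 1" and d = d
          and G = G and i = "n - 1" and t = t and k = k])
      show "((\<lambda>s. b s i) has_vector_derivative b t i * (d t (i + q) - d t i)) (at t within ?I)" if t: "t \<in> ?I" for t i
        unfolding d_def sum_ext0_diff using sol t unfolding sol2_def by blast
      show "((\<lambda>s. 1) has_vector_derivative 1 * (d t (i - 1) - d t i + b t i * (\<Prod>l=i + 1..i + q. 1) -
            (if q < i then b t (i - q - 1) * (\<Prod>l=i - q - 1 + 1..i - q - 1 + q. 1) else 0))) (at t within ?I)"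
        if "1 \<le> i" for t and i :: nat
        using sum_ext0_step[OF that, where q = q and b = "b t"] by (simp add: d_def)
      have "d t 0 = (\<Sum>j\<le>q. if j = 0 then b t 0 else 0)" for t
        unfolding d_def by (rule sum.cong) (auto simp: ext0_def)
      then show "d t 0 = b t 0 * (\<Prod>l=0 + 1..0 + q. 1)" for t by simp
      show "\<exists>C. \<forall>i. norm (b t i) \<le> C" if "t \<in> ?I" for t
        using that sol unfolding sol2_def by blast
    qed (use q n t G in auto)
    then show "S2_num q b0 n k t sums (hess_pow q (b t) (\<lambda>_. 1) (unit_seq 0) k (n - 1) * exp (G t))"
      by (simp only: S2_num_def[abs_def] S2_0_def bpow_L2[OF q] b0)
  qed auto
qed

lemma S2_den_eq_S2_num: "S2_den q b n t = S2_num q b n (n - 1) t"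
  by (auto simp: S2_den_def S2_num_def)

lemma sol2_moments:
  assumes q: "q \<ge> 1" and sol: "sol2 q \<delta> b0 b" and t: "t \<in> {0..<\<delta>}" and n: "1 \<le> n" "n \<le> q"
  shows "summable (S2_num q b0 n k t)" "summable (S2_den q b0 n t)" "suminf (S2_den q b0 n t) \<noteq> 0"
    "S2 q b0 n k t = hess_pow q (b t) (\<lambda>_. 1) (unit_seq 0) k (n - 1)"
proof -
  from sol2_moment_sums[OF q sol n] obtain E where E: "\<And>t. E t \<noteq> 0"
    "\<And>t k. t \<in> {0..<\<delta>} \<Longrightarrow> S2_num q b0 n k t sums (hess_pow q (b t) (\<lambda>_. 1) (unit_seq 0) k (n - 1) * E t)" by blast
  have num: "S2_num q b0 n k t sums (hess_pow q (b t) (\<lambda>_. 1) (unit_seq 0) k (n - 1) * E t)"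
    by (rule E(2)[OF t])
  \<comment> \<open>The denominator starts at index \<open>n - 1\<close> because this is the first
    nonzero moment in the entry, and it is constantly 1.\<close>
  have "hess_pow q (b t) (\<lambda>_. 1) (unit_seq 0) (n - 1) (n - 1) = 1"
    using n by (subst hess_pow_unit_0_low) auto
  with E(2)[OF t, of "n - 1"] have den: "S2_den q b0 n t sums E t"
    by (simp add: S2_den_eq_S2_num)
  show "summable (S2_num q b0 n k t)" "summable (S2_den q b0 n t)" "suminf (S2_den q b0 n t) \<noteq> 0"
    "S2 q b0 n k t = hess_pow q (b t) (\<lambda>_. 1) (unit_seq 0) k (n - 1)"
    using num den E(1) by (auto simp: S2_def sums_iff)
qed

text \<open>The quotient equals the pivot at \<open>i + q\<close> divided by the pivot at
  \<open>i\<close>. The moment matrix appears transposed because \<open>hess_pow\<close> describes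
  the transpose of \<open>L2\<close>.\<close>

lemma sol2_formula:
  assumes q: "q \<ge> 1" and sol: "sol2 q \<delta> b0 b" and t: "t \<in> {0..<\<delta>}"
  shows "b t i = D2 q b0 t (i + q + 1) * D2 q b0 t i / (D2 q b0 t (i + q) * D2 q b0 t (i + 1))"
proof -
  let ?g = "pivot q (b t) (\<lambda>_. 1)"
  have "D2 q b0 t N = (\<Prod>n<N. ?g n)" for N
  proof -
    have "S2 q b0 (j mod q + 1) k t = hess_pow q (b t) (\<lambda>_. 1) (unit_seq 0) k (j mod q)" for j k
      using sol2_moments(4)[OF q sol t, of "j mod q + 1" k] q by (simp add: Suc_le_eq)
    then have "D2 q b0 t N = det (transpose_mat (mat N N (\<lambda>(i, j). hess_pow q (b t) (\<lambda>_. 1) (unit_seq 0) (i div q + j) (i mod q))))"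
      unfolding D2_def by (auto intro!: arg_cong[of _ _ det] eq_matI simp: add.commute)
    also have "\<dots> = (\<Prod>n<N. ?g n)"
      by (subst Determinant.det_transpose[of _ N]) (auto simp: det_moments[OF q])
    finally show ?thesis .
  qed
  moreover have "?g n \<noteq> 0" for n using sol t by (intro pivot_neq_0) (auto simp: sol2_def)
  moreover have "?g (i + q) = ?g i * b t i" by (simp add: pivot_add[OF q])
  ultimately show ?thesis by simp
qed

subsection \<open>Existence\<close>

text \<open>Comparing powers of \<open>t\<close> turns the quadratic right-hand side of the system
  into a Cauchy product.\<close>

fun sol2_taylor_coeff :: "nat \<Rightarrow> (nat \<Rightarrow> complex) \<Rightarrow> nat \<Rightarrow> nat \<Rightarrow> complex" where
  "sol2_taylor_coeff q b 0 i = b i"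
| "sol2_taylor_coeff q b (Suc k) i = (\<Sum>m\<le>k. sol2_taylor_coeff q b m i *
      ((\<Sum>j=1..q. ext0 (sol2_taylor_coeff q b (k - m)) (int i + int j))
        - (\<Sum>j=1..q. ext0 (sol2_taylor_coeff q b (k - m)) (int i - int j)))) / of_nat (Suc k)"

text \<open>Dividing by the number of summands keeps the growth geometric, and
  \<open>2 * real q\<close> counts the terms of the two inner sums. Uniformity in \<open>i\<close>
  yields a common radius of convergence.\<close>

lemma norm_sol2_taylor_coeff_le:
  assumes b: "\<And>i. norm (b i) \<le> C"
  shows "norm (sol2_taylor_coeff q b k i) \<le> C * (2 * real q * C) ^ k"
proof (induction k arbitrary: i rule: less_induct)
  case (less k)
  have C: "C \<ge> 0" using b[of 0] norm_ge_zero order_trans by blast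
  let ?M = "2 * real q * C"
  show ?case
  proof (cases k)
    case 0
    then show ?thesis using b by simp
  next
    case (Suc n)
    have e: "norm (ext0 (sol2_taylor_coeff q b m) l) \<le> C * ?M ^ m" if "m \<le> n" for m l
      using less[of m] that Suc C by (auto simp: ext0_def)
    have s: "norm (\<Sum>j=1..q. ext0 (sol2_taylor_coeff q b m) (f j)) \<le> real q * (C * ?M ^ m)" if "m \<le> n" for m f
      using sum_norm_bound[of "{1..q}" "\<lambda>j. ext0 (sol2_taylor_coeff q b m) (f j)" "C * ?M ^ m"] e[OF that] by simp
    have "norm (\<Sum>m\<le>n. sol2_taylor_coeff q b m i *
      ((\<Sum>j=1..q. ext0 (sol2_taylor_coeff q b (n - m)) (int i + int j))
        - (\<Sum>j=1..q. ext0 (sol2_taylor_coeff q b (n - m)) (int i - int j))))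
       \<le> real (card {..n}) * (C * (?M * ?M ^ n))"
    proof (rule sum_norm_bound)
      fix m assume m: "m \<in> {..n}"
      have "norm ((\<Sum>j=1..q. ext0 (sol2_taylor_coeff q b (n - m)) (int i + int j))
        - (\<Sum>j=1..q. ext0 (sol2_taylor_coeff q b (n - m)) (int i - int j)))
          \<le> real q * (C * ?M ^ (n - m)) + real q * (C * ?M ^ (n - m))"
        by (intro norm_triangle_le_diff add_mono s) auto
      also have "\<dots> = ?M * ?M ^ (n - m)" by simp
      finally have "norm (sol2_taylor_coeff q b m i *
      ((\<Sum>j=1..q. ext0 (sol2_taylor_coeff q b (n - m)) (int i + int j))
        - (\<Sum>j=1..q. ext0 (sol2_taylor_coeff q b (n - m)) (int i - int j))))
          \<le> (C * ?M ^ m) * (?M * ?M ^ (n - m))"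
        unfolding norm_mult using less[of m] m Suc C by (intro mult_mono) auto
      also have "\<dots> = C * (?M * (?M ^ m * ?M ^ (n - m)))" by (simp only: ac_simps)
      also have "?M ^ m * ?M ^ (n - m) = ?M ^ n" using m by (simp flip: power_add)
      finally show "norm (sol2_taylor_coeff q b m i *
      ((\<Sum>j=1..q. ext0 (sol2_taylor_coeff q b (n - m)) (int i + int j))
        - (\<Sum>j=1..q. ext0 (sol2_taylor_coeff q b (n - m)) (int i - int j))))
          \<le> C * (?M * ?M ^ n)" .
    qed
    then show ?thesis unfolding Suc sol2_taylor_coeff.simps norm_divide
      by (simp add: divide_le_eq mult.commute del: of_nat_Suc)
  qed
qed

text \<open>The bound uniform on each \<open>{0..T}\<close> goes beyond \<open>sol2\<close>; the
  first system needs it to bound its exponents.\<close>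

lemma sol2_exists:
  assumes q: "q \<ge> 1" and nz: "\<And>i. b0 i \<noteq> 0" and bdd: "\<exists>C. \<forall>i. norm (b0 i) \<le> C"
  shows "\<exists>\<delta> b. 0 < \<delta> \<and> sol2 q \<delta> b0 b \<and> (\<forall>T\<in>{0..<\<delta>}. \<exists>C. \<forall>s\<in>{0..T}. \<forall>i. norm (b s i) \<le> C)"
proof -
  obtain C where C: "\<And>i. norm (b0 i) \<le> C" using bdd by blast
  have C0: "C > 0" using C[of 0] nz[of 0] by (meson less_le_trans zero_less_norm_iff)
  define M where "M = 2 * real q * C"
  have M: "M > 0" using C0 q by (simp add: M_def)
  define c where "c = sol2_taylor_coeff q b0"
  have cb: "norm (c k i) \<le> C * M ^ k" for k i
    unfolding c_def M_def by (rule norm_sol2_taylor_coeff_le[OF C])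
  define f where "f z i = (\<Sum>k. c k i * z ^ k)" for z i
  have nsum: "summable (\<lambda>k. norm (c k i * z ^ k))" and fle: "norm (f z i) \<le> C / (1 - M * norm z)"
    if z: "norm z < 1 / M" for z i
  proof -
    have Mz: "norm (M * norm z) < 1" using z M by (simp add: field_simps)
    have g: "(\<lambda>k. C * (M * norm z) ^ k) sums (C * (1 / (1 - M * norm z)))"
      by (intro sums_mult geometric_sums Mz)
    have le: "norm (c k i * z ^ k) \<le> C * (M * norm z) ^ k" for k
      using mult_right_mono[OF cb[of k i], of "norm z ^ k"] by (simp add: norm_mult norm_power power_mult_distrib mult.assoc)
    show "summable (\<lambda>k. norm (c k i * z ^ k))"
      by (rule summable_comparison_test'[OF sums_summable[OF g]]) (use le in auto)
    show "norm (f z i) \<le> C / (1 - M * norm z)"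
      unfolding f_def using norm_suminf_le[OF le sums_summable[OF g]] sums_unique[OF g] by simp
  qed
  have csum: "summable (\<lambda>k. c k i * z ^ k)" if "norm z < 1 / M" for z i
    using nsum[OF that] by (rule summable_norm_cancel)
  have ext0_sums: "(\<lambda>k. ext0 (c k) l * z ^ k) sums ext0 (f z) l" if "norm z < 1 / M" for z l
    using csum[OF that] by (auto simp: ext0_def f_def intro: summable_sums)
  have extn: "summable (\<lambda>k. norm (ext0 (c k) l * z ^ k))" if "norm z < 1 / M" for z l
  proof (cases "l < 0")
    case False
    then show ?thesis using nsum[OF that, of "nat l"] by (simp only: ext0_def if_False)
  qed (simp add: ext0_def)
  define g where "g k i = (\<Sum>j=1..q. ext0 (c k) (int i + int j)) - (\<Sum>j=1..q. ext0 (c k) (int i - int j))" for k i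
  define \<gamma> where "\<gamma> x i = (\<Sum>j=1..q. ext0 x (int i + int j)) - (\<Sum>j=1..q. ext0 x (int i - int j))" for x i
  have gs: "(\<lambda>k. g k i * z ^ k) sums \<gamma> (f z) i" if "norm z < 1 / M" for z i
    unfolding g_def \<gamma>_def left_diff_distrib sum_distrib_right
    by (intro sums_diff sums_sum ext0_sums that)
  have gn: "summable (\<lambda>k. norm (g k i * z ^ k))" if z: "norm z < 1 / M" for z i
  proof (rule summable_comparison_test')
    show "summable (\<lambda>k. (\<Sum>j=1..q. norm (ext0 (c k) (int i + int j) * z ^ k)) + (\<Sum>j=1..q. norm (ext0 (c k) (int i - int j) * z ^ k)))"
      by (intro summable_add summable_sum extn z)
    have "norm (g k i * z ^ k) \<le> (\<Sum>j=1..q. norm (ext0 (c k) (int i + int j) * z ^ k)) + (\<Sum>j=1..q. norm (ext0 (c k) (int i - int j) * z ^ k))" for k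
      unfolding g_def left_diff_distrib sum_distrib_right
      by (intro norm_triangle_le_diff add_mono norm_sum)
    then show "norm (norm (g k i * z ^ k)) \<le> (\<Sum>j=1..q. norm (ext0 (c k) (int i + int j) * z ^ k)) + (\<Sum>j=1..q. norm (ext0 (c k) (int i - int j) * z ^ k))" for k
      by (simp only: real_norm_def abs_norm_cancel)
  qed
  have df: "((\<lambda>z. f z i) has_field_derivative f z i * \<gamma> (f z) i) (at z)" if z: "norm z < 1 / M" for z i
  proof -
    have "((\<lambda>z. f z i) has_field_derivative (\<Sum>k. diffs (\<lambda>k. c k i) k * z ^ k)) (at z)"
      unfolding f_def by (rule termdiffs_strong'[OF csum z])
    moreover have "diffs (\<lambda>k. c k i) k * z ^ k = (\<Sum>m\<le>k. (c m i * z ^ m) * (g (k - m) i * z ^ (k - m)))" for k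
    proof -
      have "diffs (\<lambda>k. c k i) k = (\<Sum>m\<le>k. c m i * g (k - m) i)"
        by (simp add: diffs_def c_def g_def del: of_nat_Suc)
      moreover have "c m i * g (k - m) i * z ^ k = (c m i * z ^ m) * (g (k - m) i * z ^ (k - m))" if "m \<le> k" for m
        using that by (simp add: ac_simps flip: power_add)
      ultimately show ?thesis by (auto simp only: sum_distrib_right atMost_iff intro!: sum.cong)
    qed
    moreover have "(\<lambda>k. \<Sum>m\<le>k. (c m i * z ^ m) * (g (k - m) i * z ^ (k - m))) sums (f z i * \<gamma> (f z) i)"
      using Cauchy_product_sums[OF nsum[OF z] gn[OF z], of i i] sums_unique[OF gs[OF z, of i]]
      by (simp add: f_def)
    ultimately show ?thesis by (simp add: sums_iff)
  qed
  define \<delta> where "\<delta> = 1 / M"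
  define b where "b t = f (complex_of_real t)" for t :: real
  have \<delta>: "\<delta> > 0" using M by (simp add: \<delta>_def)
  have nt: "norm (complex_of_real t) < 1 / M" if "t \<in> {0..<\<delta>}" for t using that by (auto simp: \<delta>_def)
  have db: "((\<lambda>s. b s i) has_vector_derivative b t i * \<gamma> (b t) i) (at t within {0..<\<delta>})" if "t \<in> {0..<\<delta>}" for t i
    unfolding b_def by (rule has_vector_derivative_real_field[OF df[OF nt[OF that]]])
  have cont: "continuous_on {0..<\<delta>} (\<lambda>t. b t i)" for i
    by (rule continuous_on_vector_derivative[OF db])
  have b0: "b 0 = b0"
    by (simp add: b_def f_def c_def fun_eq_iff)
  have loc: "\<exists>C. \<forall>s\<in>{0..T}. \<forall>i. norm (b s i) \<le> C" if T: "T \<in> {0..<\<delta>}" for T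
  proof (intro exI ballI allI)
    fix s i assume s: "s \<in> {0..T}"
    have "norm (b s i) \<le> C / (1 - M * norm (complex_of_real s))"
      unfolding b_def by (rule fle[OF nt]) (use s T in auto)
    also have "\<dots> \<le> C / (1 - M * T)"
    proof (rule divide_left_mono)
      have MT: "M * T < 1" using T M by (simp add: \<delta>_def field_simps)
      have "M * s \<le> M * T" using s M by simp
      then show "1 - M * T \<le> 1 - M * norm (complex_of_real s)" using s by simp
      show "0 < (1 - M * norm (complex_of_real s)) * (1 - M * T)"
        using MT \<open>M * s \<le> M * T\<close> s by (intro mult_pos_pos) auto
    qed (use C0 in simp)
    finally show "norm (b s i) \<le> C / (1 - M * T)" .
  qed
  have "sol2 q \<delta> b0 b"
    unfolding sol2_def
  proof (intro conjI ballI allI b0)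
    fix t assume t: "t \<in> {0..<\<delta>}"
    show "\<exists>C. \<forall>i. norm (b t i) \<le> C" proof -
      from loc[OF t] obtain C where "\<forall>s\<in>{0..t}. \<forall>i. norm (b s i) \<le> C" by (elim exE)
      moreover have "t \<in> {0..t}" using t by simp
      ultimately show ?thesis by blast
    qed
    fix i
    show "((\<lambda>s. b s i) has_vector_derivative b t i *
       ((\<Sum>j=1..q. ext0 (b t) (int i + int j)) - (\<Sum>j=1..q. ext0 (b t) (int i - int j)))) (at t within {0..<\<delta>})"
      using db[OF t] by (simp add: \<gamma>_def)
    have "continuous_on {0..<\<delta>} (\<lambda>t. \<gamma> (b t) i)"
      unfolding \<gamma>_def by (intro continuous_intros continuous_on_ext0 cont)
    from antiderivative_half_open[OF this] obtain G where G: "G 0 = 0"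
      "\<And>t. t \<in> {0..<\<delta>} \<Longrightarrow> (G has_vector_derivative \<gamma> (b t) i) (at t within {0..<\<delta>})"
      by blast
    \<comment> \<open>Along the solution the equation is linear in \<open>b t i\<close> with
      coefficient \<open>\<gamma> (b t) i\<close>, so the nonzero initial value persists.\<close>
    have "b t i = b 0 i * exp (G t)"
      by (rule linear_ode_solution[OF db G(2) G(1) t])
    then show "b t i \<noteq> 0" using nz b0 by simp
  qed
  with \<delta> loc show ?thesis by blast
qed

text \<open>
  If \<open>a\<close> solves the first system then \<open>b i = a i * \<dots> * a (i + r - 1)\<close> solves the second one with
  \<open>q = r\<close>, and \<open>a\<close> is recovered from \<open>b\<close> by the linear equations
  \<open>a i' = a i * (b (i + 1) - b (i - r))\<close>.
\<close>
lemma sol1_exists: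
  assumes r: "r \<ge> 1" and nz: "\<And>i. a0 i \<noteq> 0" and bdd: "\<exists>C. \<forall>i. norm (a0 i) \<le> C"
  shows "\<exists>\<delta> a. 0 < \<delta> \<and> sol1 r \<delta> a0 a"
proof -
  obtain C where C: "\<And>i. norm (a0 i) \<le> C" using bdd by blast
  define b0 where "b0 i = (\<Prod>l=i..<i + r. a0 l)" for i
  have b0_nz: "b0 i \<noteq> 0" for i by (simp add: b0_def nz)
  have "norm (b0 i) \<le> C ^ r" for i
    unfolding b0_def prod_norm[symmetric] using prod_mono[of "{i..<i + r}" "\<lambda>l. norm (a0 l)" "\<lambda>_. C"] C by simp
  then have b0_bdd: "\<exists>C. \<forall>i. norm (b0 i) \<le> C" by blast
  from sol2_exists[OF r b0_nz b0_bdd] obtain \<delta> b where \<delta>: "0 < \<delta>" and sol: "sol2 r \<delta> b0 b"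
    and loc: "\<forall>T\<in>{0..<\<delta>}. \<exists>C. \<forall>s\<in>{0..T}. \<forall>i. norm (b s i) \<le> C"
    by (elim exE conjE)
  let ?I = "{0..<\<delta>}"
  have cont: "continuous_on ?I (\<lambda>t. b t i)" for i by (rule sol2_continuous[OF sol])
  have "\<exists>G. G 0 = 0 \<and> (\<forall>t\<in>?I. (G has_vector_derivative b t (i + 1) - ext0 (b t) (int i - int r)) (at t within ?I))" for i
  proof -
    have "continuous_on ?I (\<lambda>t. b t (i + 1) - ext0 (b t) (int i - int r))"
      by (intro continuous_intros continuous_on_ext0 cont)
    then show ?thesis by (rule antiderivative_half_open)
  qed
  then obtain G where G0: "\<And>i. G i 0 = 0"
    and G: "\<And>i t. t \<in> ?I \<Longrightarrow> (G i has_vector_derivative b t (i + 1) - ext0 (b t) (int i - int r)) (at t within ?I)"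
    by metis
  define a where "a t i = a0 i * exp (G i t)" for t i
  have prod_a: "(\<Prod>l=i..<i + r. a t l) = b t i" if t: "t \<in> ?I" for t i
  proof -
    \<comment> \<open>Over the window \<open>i..<i + r\<close> the derivatives of the
      \<open>G l\<close> add up to the coefficient in the equation for \<open>b t i\<close>.\<close>
    have "b t i = b 0 i * exp (\<Sum>l=i..<i + r. G l t)"
    proof (rule linear_ode_solution[OF _ _ _ t])
      fix s assume s: "s \<in> ?I"
      show "((\<lambda>s. b s i) has_vector_derivative b s i *
         ((\<Sum>j=1..r. ext0 (b s) (int i + int j)) - (\<Sum>j=1..r. ext0 (b s) (int i - int j)))) (at s within ?I)"
        using sol s unfolding sol2_def by blast
      have "((\<lambda>s. \<Sum>l=i..<i + r. G l s) has_vector_derivative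
          (\<Sum>l=i..<i + r. b s (l + 1) - ext0 (b s) (int l - int r))) (at s within ?I)"
        by (intro has_vector_derivative_sum G s)
      moreover have "(\<Sum>l=i..<i + r. b s (l + 1)) = (\<Sum>j=1..r. ext0 (b s) (int i + int j))"
        by (rule sum.reindex_bij_witness[of _ "\<lambda>j. i + j - 1" "\<lambda>l. l + 1 - i"]) (auto simp: ext0_def nat_add_distrib)
      moreover have "(\<Sum>l=i..<i + r. ext0 (b s) (int l - int r)) = (\<Sum>j=1..r. ext0 (b s) (int i - int j))"
        by (rule sum.reindex_bij_witness[of _ "\<lambda>j. i + r - j" "\<lambda>l. i + r - l"]) (auto simp: of_nat_diff)
      ultimately show "((\<lambda>s. \<Sum>l=i..<i + r. G l s) has_vector_derivative
         ((\<Sum>j=1..r. ext0 (b s) (int i + int j)) - (\<Sum>j=1..r. ext0 (b s) (int i - int j)))) (at s within ?I)"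
        by (simp add: sum_subtractf)
    qed (simp add: G0)
    moreover have "b 0 = b0" using sol by (simp add: sol2_def)
    ultimately show ?thesis by (simp add: a_def b0_def prod.distrib exp_sum)
  qed
  have "sol1 r \<delta> a0 a"
    unfolding sol1_def
  proof (intro conjI ballI allI)
    show "a 0 = a0" by (auto simp: a_def G0)
    fix t assume t: "t \<in> ?I"
    \<comment> \<open>\<open>G i t\<close> accumulates over all of \<open>{0..t}\<close>, and its
      bound must not depend on \<open>i\<close>; a bound at time \<open>t\<close> alone would not
      do.\<close>
    obtain K where K: "\<And>s i. s \<in> {0..t} \<Longrightarrow> norm (b s i) \<le> K" using loc t by meson
    have "norm (b 0 0) \<le> K" using t by (intro K) auto
    then have K0: "K \<ge> 0" using norm_ge_zero order_trans by blast
    have Gle: "norm (G i t) \<le> 2 * K * t" for i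
    proof -
      have "norm (G i t - G i 0) \<le> 2 * K * norm (t - 0)"
      proof (rule differentiable_bound)
        fix s assume s: "s \<in> {0..t}"
        let ?d = "b s (i + 1) - ext0 (b s) (int i - int r)"
        have "(G i has_vector_derivative ?d) (at s within {0..t})"
          by (rule has_vector_derivative_within_subset[OF G]) (use s t in auto)
        then show "(G i has_derivative (\<lambda>h. h *\<^sub>R ?d)) (at s within {0..t})"
          by (simp add: has_vector_derivative_def)
        have "norm (ext0 (b s) (int i - int r)) \<le> K" using K[OF s] K0 by (simp add: ext0_def)
        then have "norm ?d \<le> 2 * K" using K[OF s, of "i + 1"] by (intro norm_triangle_le_diff) simp
        then show "onorm (\<lambda>h. h *\<^sub>R ?d) \<le> 2 * K"
          by (intro onorm_le) (simp add: mult.commute mult_left_mono)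
      qed (use t in auto)
      then show ?thesis using t by (simp add: G0)
    qed
    show "\<exists>C. \<forall>i. norm (a t i) \<le> C"
    proof (intro exI allI)
      fix i
      have "norm (exp (G i t)) \<le> exp (2 * K * t)"
        using Gle[of i] by (meson exp_le_cancel_iff norm_exp order_trans)
      then show "norm (a t i) \<le> C * exp (2 * K * t)"
        unfolding a_def norm_mult using C[of i] order_trans[OF norm_ge_zero C[of i]] by (intro mult_mono) auto
    qed
    fix i
    show "a t i \<noteq> 0" using nz by (simp add: a_def)
    have "(\<Prod>j=1..r. ext0 (a t) (int i + int j)) = b t (i + 1)"
      unfolding prod_ext0_right prod_a[OF t, symmetric] by (intro prod.cong) auto
    \<comment> \<open>For \<open>i < r\<close> both sides are 0, as the product has a factor with
      negative index.\<close>
    moreover have "(\<Prod>j=1..r. ext0 (a t) (int i - int j)) = ext0 (b t) (int i - int r)"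
      unfolding prod_ext0_left using prod_a[OF t, of "i - r"] by (auto simp: ext0_def nat_diff_distrib)
    moreover have "((\<lambda>s. a s i) has_vector_derivative a t i * (b t (i + 1) - ext0 (b t) (int i - int r))) (at t within ?I)"
      using has_vector_derivative_mult_right[OF has_vector_derivative_exp_comp[OF G[OF t, of i]], of "a0 i"]
      by (simp add: a_def mult_ac)
    ultimately show "((\<lambda>s. a s i) has_vector_derivative
        a t i * ((\<Prod>j=1..r. ext0 (a t) (int i + int j)) - (\<Prod>j=1..r. ext0 (a t) (int i - int j)))) (at t within ?I)"
      by simp
  qed
  with \<delta> show ?thesis by blast
qed

section \<open>Restriction to a common time interval and conclusion\<close>

lemma sol1_subinterval:
  assumes "sol1 r \<delta> a0 a" "\<delta>' \<le> \<delta>"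
  shows "sol1 r \<delta>' a0 a"
proof -
  have "{0..<\<delta>'} \<subseteq> {0..<\<delta>}" using assms(2) by auto
  with assms(1) show ?thesis
    unfolding sol1_def by (blast intro: has_vector_derivative_within_subset)
qed

lemma sol2_subinterval:
  assumes "sol2 q \<delta> b0 b" "\<delta>' \<le> \<delta>"
  shows "sol2 q \<delta>' b0 b"
proof -
  have "{0..<\<delta>'} \<subseteq> {0..<\<delta>}" using assms(2) by auto
  with assms(1) show ?thesis
    unfolding sol2_def by (blast intro: has_vector_derivative_within_subset)
qed

theorem theorem2:
  fixes r q :: nat and a0 b0 :: "nat \<Rightarrow> complex"
  assumes "r \<ge> 1" and "q \<ge> 1"
    and "\<forall>i. a0 i \<noteq> 0" and "\<exists>C. \<forall>i. norm (a0 i) \<le> C"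
    and "\<forall>i. b0 i \<noteq> 0" and "\<exists>C. \<forall>i. norm (b0 i) \<le> C"
  shows "\<exists>\<delta>>0.
     (\<forall>t\<in>{0..<\<delta>}. \<forall>m k. 1 \<le> m \<and> m \<le> r \<longrightarrow> summable (S1_num r a0 m k t) \<and> summable (S1_den r a0 t)
                              \<and> suminf (S1_den r a0 t) \<noteq> 0) \<and>
     (\<forall>t\<in>{0..<\<delta>}. \<forall>n k. 1 \<le> n \<and> n \<le> q \<longrightarrow>
                              summable (S2_num q b0 n k t) \<and> summable (S2_den q b0 n t)
                              \<and> suminf (S2_den q b0 n t) \<noteq> 0) \<and>
     (\<exists>a. sol1 r \<delta> a0 a) \<and>
     (\<exists>b. sol2 q \<delta> b0 b) \<and>
     (\<forall>a. sol1 r \<delta> a0 a \<longrightarrow> (\<forall>t\<in>{0..<\<delta>}. \<forall>i.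
          a t i = D1 r a0 t (i + 2) * D1 r a0 t i / (D1 r a0 t (i + 1))\<^sup>2)) \<and>
     (\<forall>b. sol2 q \<delta> b0 b \<longrightarrow> (\<forall>t\<in>{0..<\<delta>}. \<forall>i.
          b t i = D2 q b0 t (i + q + 1) * D2 q b0 t i / (D2 q b0 t (i + q) * D2 q b0 t (i + 1))))"
proof -
  obtain \<delta>1 a where 1: "0 < \<delta>1" "sol1 r \<delta>1 a0 a" using sol1_exists[of r a0] assms by blast
  obtain \<delta>2 b where 2: "0 < \<delta>2" "sol2 q \<delta>2 b0 b" using sol2_exists[of q b0] assms by blast
  \<comment> \<open>No further shrinking: the denominators are nonzero on any interval that carries
    a solution.\<close>
  define \<delta> where "\<delta> = min \<delta>1 \<delta>2"
  have "\<delta> > 0" using 1 2 by (simp add: \<delta>_def)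
  have a: "sol1 r \<delta> a0 a" by (rule sol1_subinterval[OF 1(2)]) (simp add: \<delta>_def)
  have b: "sol2 q \<delta> b0 b" by (rule sol2_subinterval[OF 2(2)]) (simp add: \<delta>_def)
  show ?thesis
  proof (intro exI[of _ \<delta>] conjI ballI allI impI \<open>\<delta> > 0\<close>)
    show "\<exists>a. sol1 r \<delta> a0 a" "\<exists>b. sol2 q \<delta> b0 b" using a b by blast+
  next
    fix t m k assume "t \<in> {0..<\<delta>}" "1 \<le> m \<and> m \<le> r"
    then show "summable (S1_num r a0 m k t)" "summable (S1_den r a0 t)" "suminf (S1_den r a0 t) \<noteq> 0"
      using sol1_moments(1-3)[OF assms(1) a] by blast+
  next
    fix t n k assume "t \<in> {0..<\<delta>}" "1 \<le> n \<and> n \<le> q"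
    then show "summable (S2_num q b0 n k t)" "summable (S2_den q b0 n t)" "suminf (S2_den q b0 n t) \<noteq> 0"
      using sol2_moments(1-3)[OF assms(2) b] by blast+
  qed (use sol1_formula[OF assms(1)] sol2_formula[OF assms(2)] in blast)+
qed

end
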